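(* Let $(a_k)_{k\in\mathbb{Z}}$ be a finitely supported real mask whose symbol $a(z)=\sum_k a_k z^k$ satisfies $a(-1)=0$, $a(1)=2$ and factorizes as $a(z)=2^{-r}(1+z)^{r+1}b(z)$ for some integer $r\ge 0$ and some Laurent polynomial $b(z)=\sum_{k=-p}^{p} b_kz^k$ with $p\ge 1$, $b_p\ne 0$ and $b_{-k}=b_k$ for all $k$. Let $B(\xi)=b(e^{-i\xi})=b_0+2\sum_{k=1}^p b_k\cos(k\xi)$, let $M$ be the $(2p-1)\times(2p-1)$ matrix $M=(b_{k-2\ell})_{k,\ell=-p+1,\ldots,p-1}$ (with $b_k=0$ for $|k|>p$), and let $\rho$ be the spectral radius of $M$. For $j\ge 0$ let $b_{j,k}$ be the coefficients of $b_j(z)=\sum_k b_{j,k}z^k:=b(z)b(z^2)\cdots b(z^{2^{j-1}})$ (with $b_0(z):=1$). If $B(\xi)\ge 0$ for all $\xi\in[-\pi,\pi]$, then $$\lim_{j\to\infty} b_{j,0}^{1/j}=\rho,$$ and if $\rho\ge 1/2$, then $r-\log_2(\rho)$ is a lower bound for the Hölder regularity of the subdivision scheme $f_{j+1,k}=\sum_\ell a_{k-2\ell}f_{j,\ell}$; that is, for every real $\beta$ with $0\le\beta<r-\log_2(\rho)$, the limit function $f$ of the scheme belongs to $C^\beta$ for all finitely supported initial data.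
   Context: Subdivision scheme: given a finitely supported mask $(a_k)$ and real initial data $(f_{0,k})_{k\in\mathbb{Z}}$ with only finitely many non-zero terms, define $f_{j+1,k}=\sum_\ell a_{k-2\ell}f_{j,\ell}$ for $j\ge0$. Let $f_j$ be the piecewise linear function with value $f_{j,k}$ at $2^{-j}k$. The limit function is the pointwise limit $f=\lim_{j\to\infty}f_j$ (the scheme is convergent if this limit exists); "$f\in C^\beta$" includes that the limit exists. Hölder classes: for $0<\alpha<1$, $f\in C^\alpha$ means $|f(x)-f(y)|\le C|x-y|^\alpha$ for all $x,y\in\mathbb{R}$ and some constant $C$. For $q\in\mathbb{N}_0$, $f\in C^q$ means $f$ is $q$ times continuously differentiable, and $f\in C^{q+\alpha}$ means $f\in C^q$ and $f^{(q)}\in C^\alpha$. The scheme has Hölder regularity $\gamma\ge0$ if for $\beta<\gamma$, $f\in C^\beta$ for all initial data, and for $\beta>\gamma$, $f\notin C^\beta$ for some initial data. *)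

theory Defs
  imports
    "HOL-Analysis.Analysis"
    "HOL-Library.Poly_Mapping"
    "Jordan_Normal_Form.Spectral_Radius"
begin

text \<open>
  The type \<^typ>\<open>int \<Rightarrow>\<^sub>0 real\<close> of finitely supported functions, whose multiplication is
  convolution, is the ring of real Laurent polynomials: \<^term>\<open>Poly_Mapping.lookup p k\<close> is the
  coefficient of \<open>z\<^sup>k\<close>. A finitely supported mask is therefore the same object as its symbol.
\<close>

type_synonym laurent = "int \<Rightarrow>\<^sub>0 real"

abbreviation lcoeff :: "laurent \<Rightarrow> int \<Rightarrow> real" where
  "lcoeff \<equiv> Poly_Mapping.lookup"

definition lconst :: "real \<Rightarrow> laurent" where
  "lconst c = Poly_Mapping.single 0 c"

definition lZ :: laurent where
  "lZ = Poly_Mapping.single 1 1"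

definition leval :: "laurent \<Rightarrow> complex \<Rightarrow> complex" where
  "leval p z = (\<Sum>k\<in>Poly_Mapping.keys p. of_real (lcoeff p k) * z powi k)"

text \<open>The Laurent polynomial \<open>p(z\<^sup>n)\<close>.\<close>

definition lsubst_pow :: "nat \<Rightarrow> laurent \<Rightarrow> laurent" where
  "lsubst_pow n p = (\<Sum>k\<in>Poly_Mapping.keys p. Poly_Mapping.single (int n * k) (lcoeff p k))"

text \<open>\<open>b\<^sub>j(z) = b(z) b(z\<^sup>2) \<dots> b(z^(2^(j-1)))\<close>\<close>

definition iterated_symbol :: "laurent \<Rightarrow> nat \<Rightarrow> laurent" where
  "iterated_symbol b j = (\<Prod>i<j. lsubst_pow (2 ^ i) b)"

text \<open>
  \<open>B(\<xi>)\<close>, for \<open>b\<close> symmetric with coefficients supported in \<open>{-p..p}\<close>;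
  see \<open>leval_eq_trig_symbol\<close> below for \<open>B(\<xi>) = b(e^(-i\<xi>))\<close>.
\<close>

definition trig_symbol :: "laurent \<Rightarrow> nat \<Rightarrow> real \<Rightarrow> real" where
  "trig_symbol b p \<xi> = lcoeff b 0 + 2 * (\<Sum>k=1..p. lcoeff b (int k) * cos (real k * \<xi>))"

text \<open>Both indices of the matrix are shifted by \<open>p - 1\<close>, from \<open>{-p+1..p-1}\<close> to \<open>{0..<2*p-1}\<close>.\<close>

definition symbol_mat :: "laurent \<Rightarrow> nat \<Rightarrow> real mat" where
  "symbol_mat b p = Matrix.mat (2 * p - 1) (2 * p - 1)
     (\<lambda>(i, j). lcoeff b ((int i - int p + 1) - 2 * (int j - int p + 1)))"

definition real_spectral_radius :: "real mat \<Rightarrow> real" where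
  "real_spectral_radius A = spectral_radius (map_mat complex_of_real A)"

lemma leval_superset:
  assumes "finite K" "Poly_Mapping.keys p \<subseteq> K"
  shows "leval p z = (\<Sum>k\<in>K. of_real (lcoeff p k) * z powi k)"
  unfolding leval_def using assms
  by (intro sum.mono_neutral_left) (auto simp: in_keys_iff)

lemma leval_eq_trig_symbol:
  assumes supp: "\<And>k. \<bar>k\<bar> > int p \<Longrightarrow> lcoeff b k = 0"
    and sym: "\<And>k. lcoeff b (- k) = lcoeff b k"
  shows "leval b (exp (- \<i> * of_real \<xi>)) = of_real (trig_symbol b p \<xi>)"
proof -
  define g where "g k = complex_of_real (lcoeff b k) * exp (- \<i> * of_real \<xi>) powi k" for k
  have g: "g k = of_real (lcoeff b k) * cis (- (of_int k * \<xi>))" for k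
  proof -
    have "exp (- \<i> * complex_of_real \<xi>) = cis (- \<xi>)"
      by (simp add: cis_conv_exp)
    thus ?thesis by (simp add: g_def cis_power_int)
  qed
  have split: "{- int p..int p} = insert 0 (int ` {1..p} \<union> (\<lambda>k. - int k) ` {1..p})"
  proof -
    have "k \<in> int ` {1..p} \<union> (\<lambda>k. - int k) ` {1..p}"
      if "k \<in> {- int p..int p}" "k \<noteq> 0" for k
    proof (cases "k > 0")
      case True
      then show ?thesis using that by (intro UnI1 image_eqI[of _ _ "nat k"]) auto
    next
      case False
      then show ?thesis using that by (intro UnI2 image_eqI[of _ _ "nat (- k)"]) auto
    qed
    hence "{- int p..int p} \<subseteq> insert 0 (int ` {1..p} \<union> (\<lambda>k. - int k) ` {1..p})"
      by blast
    moreover have "insert 0 (int ` {1..p} \<union> (\<lambda>k. - int k) ` {1..p}) \<subseteq> {- int p..int p}"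
      by auto
    ultimately show ?thesis by (rule equalityI)
  qed
  have "Poly_Mapping.keys b \<subseteq> {- int p..int p}"
    using supp by (force simp: in_keys_iff)
  hence "leval b (exp (- \<i> * of_real \<xi>)) = (\<Sum>k\<in>{- int p..int p}. g k)"
    by (subst leval_superset) (auto simp: g_def)
  also have "\<dots> = g 0 + ((\<Sum>k\<in>int ` {1..p}. g k) + (\<Sum>k\<in>(\<lambda>k. - int k) ` {1..p}. g k))"
    unfolding split by (subst sum.insert, simp, force, subst sum.union_disjoint) auto
  also have "\<dots> = g 0 + (\<Sum>k=1..p. g (int k) + g (- int k))"
    by (simp add: sum.reindex inj_on_def sum.distrib)
  also have "\<dots> = of_real (trig_symbol b p \<xi>)"
    by (simp add: g sym trig_symbol_def complex_eq_iff sum_distrib_left sum_negf)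
  finally show ?thesis .
qed

lemma lookup_lsubst_pow:
  assumes "n > 0"
  shows "lcoeff (lsubst_pow n p) m = (if int n dvd m then lcoeff p (m div int n) else 0)"
proof -
  have "lcoeff (lsubst_pow n p) m = (\<Sum>k\<in>Poly_Mapping.keys p. if int n * k = m then lcoeff p k else 0)"
    by (simp add: lsubst_pow_def lookup_sum lookup_single when_def)
  also have "\<dots> = (if int n dvd m then lcoeff p (m div int n) else 0)"
  proof (cases "int n dvd m")
    case True
    then obtain l where l: "m = int n * l" by auto
    show ?thesis using assms by (auto simp: l in_keys_iff)
  next
    case False
    then show ?thesis by (auto intro!: sum.neutral)
  qed
  finally show ?thesis .
qed

definition hoelder_continuous :: "real \<Rightarrow> (real \<Rightarrow> real) \<Rightarrow> bool" where
  "hoelder_continuous \<alpha> f \<longleftrightarrow> (\<exists>C. \<forall>x y. \<bar>f x - f y\<bar> \<le> C * \<bar>x - y\<bar> powr \<alpha>)"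

definition cont_diff :: "nat \<Rightarrow> (real \<Rightarrow> real) \<Rightarrow> bool" where
  "cont_diff q f \<longleftrightarrow>
     (\<forall>i<q. \<forall>x. (deriv ^^ i) f differentiable (at x)) \<and> continuous_on UNIV ((deriv ^^ q) f)"

text \<open>For \<open>\<beta> = q + \<alpha> \<ge> 0\<close> with \<open>q\<close> a natural number and \<open>0 \<le> \<alpha> < 1\<close>.\<close>

definition hoelder_class :: "real \<Rightarrow> (real \<Rightarrow> real) set" where
  "hoelder_class \<beta> =
     {f. cont_diff (nat \<lfloor>\<beta>\<rfloor>) f \<and>
         (frac \<beta> > 0 \<longrightarrow> hoelder_continuous (frac \<beta>) ((deriv ^^ nat \<lfloor>\<beta>\<rfloor>) f))}"

text \<open>The sum ranges over all integers \<open>l\<close>; only finitely many terms are nonzero.\<close>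

primrec subdiv :: "laurent \<Rightarrow> (int \<Rightarrow>\<^sub>0 real) \<Rightarrow> nat \<Rightarrow> int \<Rightarrow> real" where
  "subdiv a f0 0 k = Poly_Mapping.lookup f0 k"
| "subdiv a f0 (Suc j) k = Sum_any (\<lambda>l. lcoeff a (k - 2 * l) * subdiv a f0 j l)"

text \<open>Linear interpolation on each cell of the grid \<open>2^(-j) \<int>\<close>.\<close>

definition subdiv_pl :: "laurent \<Rightarrow> (int \<Rightarrow>\<^sub>0 real) \<Rightarrow> nat \<Rightarrow> real \<Rightarrow> real" where
  "subdiv_pl a f0 j x =
     (1 - frac (2 ^ j * x)) * subdiv a f0 j \<lfloor>2 ^ j * x\<rfloor>
       + frac (2 ^ j * x) * subdiv a f0 j (\<lfloor>2 ^ j * x\<rfloor> + 1)"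

lemma subdiv_pl_grid: "subdiv_pl a f0 j (of_int k / 2 ^ j) = subdiv a f0 j k"
  by (simp add: subdiv_pl_def)

definition is_limit_function :: "laurent \<Rightarrow> (int \<Rightarrow>\<^sub>0 real) \<Rightarrow> (real \<Rightarrow> real) \<Rightarrow> bool" where
  "is_limit_function a f0 f \<longleftrightarrow> (\<forall>x. (\<lambda>j. subdiv_pl a f0 j x) \<longlonglongrightarrow> f x)"

end

theory Submission
  imports Defs
begin

text \<open>
  Since \<open>B \<ge> 0\<close>, all \<open>b\<^sub>j(e^(i\<xi>))\<close> are nonnegative, so \<open>b\<^sub>j\<^sub>,\<^sub>0\<close> is the largest coefficient of \<open>b\<^sub>j\<close> in
  absolute value. The entries of \<open>M^j\<close> are the coefficients of \<open>b\<^sub>j\<close> at \<open>k - 2^j l\<close>, and the central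
  one is \<open>b\<^sub>j\<^sub>,\<^sub>0\<close>; hence \<open>b\<^sub>j\<^sub>,\<^sub>0\<close> is the maximum norm of \<open>M^j\<close>, whose \<open>j\<close>-th root tends to \<open>\<rho>\<close>.

  Let \<open>F\<^sub>j\<close> be the generating function of \<open>f\<^sub>j\<close>. From
  \<open>(1-z)^(r+1) F\<^sub>j(z) = 2^(-rj) b\<^sub>j(z) (1-z^(2^j))^(r+1) F\<^sub>0(z^(2^j))\<close> the differences of order \<open>r+1\<close> are
  \<open>O(2^(-\<beta>j))\<close> for \<open>\<beta> < r - log\<^sub>2 \<rho>\<close>. Decay descends to lower orders: up to a multiple of the
  differences of order \<open>m+1\<close>, the difference of \<open>f\<^sub>j\<^sub>+\<^sub>1\<close> of order \<open>m \<le> r\<close> at \<open>k\<close> is \<open>2^(-m)\<close> times that of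
  \<open>f\<^sub>j\<close> at \<open>k div 2\<close>, so any rate slower than \<open>2^(-mj)\<close> is inherited. Consequently the divided differences
  of order \<open>m \<le> \<lfloor>\<beta>\<rfloor>\<close> converge uniformly, with a geometric rate, to Hoelder continuous functions, each
  of which is the derivative of the preceding one.
\<close>

section \<open>Laurent polynomials\<close>

text \<open>Expansion into monomials, through which product formulas reduce to products of single
  terms.\<close>

lemma laurent_eq_sum_single: "p = (\<Sum>k\<in>Poly_Mapping.keys p. Poly_Mapping.single k (lcoeff p k))"
  for p :: laurent
proof (rule poly_mapping_eqI)
  fix n
  show "lcoeff p n = lcoeff (\<Sum>k\<in>Poly_Mapping.keys p. Poly_Mapping.single k (lcoeff p k)) n"
    by (simp add: lookup_sum lookup_single when_def in_keys_iff)
qed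

lemma lookup_single_mult: "lcoeff (Poly_Mapping.single n c * q) k = c * lcoeff q (k - n)"
  for q :: laurent
proof -
  have "Poly_Mapping.single n c * q =
      (\<Sum>l\<in>Poly_Mapping.keys q. Poly_Mapping.single (n + l) (c * lcoeff q l))"
    by (subst laurent_eq_sum_single[of q], subst sum_distrib_left) (simp add: mult_single)
  hence "lcoeff (Poly_Mapping.single n c * q) k =
      (\<Sum>l\<in>Poly_Mapping.keys q. if l = k - n then c * lcoeff q l else 0)"
    by (simp add: lookup_sum lookup_single when_def algebra_simps eq_diff_eq)
  also have "\<dots> = c * lcoeff q (k - n)"
    by (simp add: in_keys_iff)
  finally show ?thesis .
qed

lemma lookup_mult_eq_sum:
  "lcoeff (p * q) k = (\<Sum>i\<in>Poly_Mapping.keys p. lcoeff p i * lcoeff q (k - i))"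
  for p q :: laurent
  by (subst laurent_eq_sum_single[of p]) (simp add: sum_distrib_right lookup_sum lookup_single_mult)

lemma lookup_lconst_mult: "lcoeff (lconst c * q) k = c * lcoeff q k"
  by (simp add: lconst_def lookup_single_mult)

lemma lookup_lZ_mult: "lcoeff (lZ * q) k = lcoeff q (k - 1)"
  by (simp add: lZ_def lookup_single_mult)

lemma lookup_backward_diff: "lcoeff ((1 - lZ) * q) k = lcoeff q k - lcoeff q (k - 1)"
  by (simp add: left_diff_distrib lookup_minus lookup_lZ_mult)

lemma abs_lookup_le_sum: "\<bar>lcoeff p k\<bar> \<le> (\<Sum>i\<in>Poly_Mapping.keys p. \<bar>lcoeff p i\<bar>)"
  by (cases "k \<in> Poly_Mapping.keys p") (auto simp: in_keys_iff intro!: member_le_sum sum_nonneg)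

section \<open>Evaluation at a complex number\<close>

lemma leval_single [simp]: "leval (Poly_Mapping.single n c) z = of_real c * z powi n"
  by (simp add: leval_def)

lemma leval_one [simp]: "leval 1 z = 1"
  using leval_single[of 0 1 z] by (simp del: leval_single)

lemma leval_lconst [simp]: "leval (lconst c) z = of_real c"
  by (simp add: lconst_def)

lemma leval_lZ [simp]: "leval lZ z = z"
  by (simp add: lZ_def)

lemma leval_add [simp]: "leval (p + q) z = leval p z + leval q z"
proof -
  define K where "K = Poly_Mapping.keys p \<union> Poly_Mapping.keys q"
  have "finite K" "Poly_Mapping.keys p \<subseteq> K" "Poly_Mapping.keys q \<subseteq> K" "Poly_Mapping.keys (p + q) \<subseteq> K"
    using keys_add[of p q] by (auto simp: K_def)
  thus ?thesis
    by (simp add: leval_superset[of K] lookup_add ring_distribs sum.distrib)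
qed

lemma leval_sum: "leval (sum f A) z = (\<Sum>x\<in>A. leval (f x) z)"
  by (induction A rule: infinite_finite_induct) (simp_all add: leval_def[of 0])

lemma leval_mult [simp]:
  assumes "z \<noteq> 0"
  shows "leval (p * q) z = leval p z * leval q z"
proof -
  have "p * q = (\<Sum>k\<in>Poly_Mapping.keys p. \<Sum>l\<in>Poly_Mapping.keys q.
      Poly_Mapping.single (k + l) (lcoeff p k * lcoeff q l))"
    by (subst laurent_eq_sum_single[of p], subst laurent_eq_sum_single[of q])
       (simp add: sum_product mult_single)
  hence "leval (p * q) z = (\<Sum>k\<in>Poly_Mapping.keys p. \<Sum>l\<in>Poly_Mapping.keys q.
      (of_real (lcoeff p k) * z powi k) * (of_real (lcoeff q l) * z powi l))"
    \<comment> \<open>Negative exponents occur, so \<open>z powi (k + l)\<close> splits in general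
      only for nonzero \<open>z\<close>.\<close>
    using assms by (simp add: leval_sum power_int_add mult_ac)
  also have "\<dots> = leval p z * leval q z"
    by (simp add: leval_def sum_product)
  finally show ?thesis .
qed

lemma leval_power [simp]: "z \<noteq> 0 \<Longrightarrow> leval (p ^ n) z = leval p z ^ n"
  by (induction n) simp_all

lemma leval_prod: "z \<noteq> 0 \<Longrightarrow> leval (prod f A) z = (\<Prod>x\<in>A. leval (f x) z)"
  by (induction A rule: infinite_finite_induct) simp_all

section \<open>The substitution of z^n for z\<close>

lemma leval_lsubst_pow: "leval (lsubst_pow n p) z = leval p (z ^ n)"
  unfolding lsubst_pow_def leval_sum leval_single by (simp add: leval_def power_int_mult)

lemma lsubst_pow_single: "n > 0 \<Longrightarrow> lsubst_pow n (Poly_Mapping.single k c) = Poly_Mapping.single (int n * k) c"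
  by (simp add: lsubst_pow_def)

lemma lsubst_pow_add: "n > 0 \<Longrightarrow> lsubst_pow n (p + q) = lsubst_pow n p + lsubst_pow n q"
  by (rule poly_mapping_eqI) (simp add: lookup_lsubst_pow lookup_add)

lemma lsubst_pow_diff: "n > 0 \<Longrightarrow> lsubst_pow n (p - q) = lsubst_pow n p - lsubst_pow n q"
  by (rule poly_mapping_eqI) (simp add: lookup_lsubst_pow lookup_minus)

lemma lsubst_pow_sum: "n > 0 \<Longrightarrow> lsubst_pow n (sum f A) = (\<Sum>x\<in>A. lsubst_pow n (f x))"
  by (induction A rule: infinite_finite_induct) (simp_all add: lsubst_pow_add lsubst_pow_def[of n 0])

lemma lsubst_pow_one: "n > 0 \<Longrightarrow> lsubst_pow n 1 = 1"
  using lsubst_pow_single[of n 0 1] by simp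

lemma lsubst_pow_lZ: "lsubst_pow n lZ = lZ ^ n"
proof -
  have "lZ ^ n = Poly_Mapping.single (int n) 1"
    by (induction n) (simp_all add: lZ_def mult_single)
  thus ?thesis by (simp add: lZ_def lsubst_pow_def)
qed

lemma lsubst_pow_lconst: "n > 0 \<Longrightarrow> lsubst_pow n (lconst c) = lconst c"
  by (simp add: lconst_def lsubst_pow_single)

lemma lsubst_pow_mult:
  assumes "n > 0"
  shows "lsubst_pow n (p * q) = lsubst_pow n p * lsubst_pow n q"
proof -
  have "p * q = (\<Sum>k\<in>Poly_Mapping.keys p. \<Sum>l\<in>Poly_Mapping.keys q.
      Poly_Mapping.single (k + l) (lcoeff p k * lcoeff q l))"
    by (subst laurent_eq_sum_single[of p], subst laurent_eq_sum_single[of q])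
       (simp add: sum_product mult_single)
  thus ?thesis using assms
    by (simp add: lsubst_pow_sum lsubst_pow_single distrib_left)
       (simp add: lsubst_pow_def sum_product mult_single)
qed

lemma lsubst_pow_power: "n > 0 \<Longrightarrow> lsubst_pow n (p ^ m) = lsubst_pow n p ^ m"
  by (induction m) (simp_all add: lsubst_pow_mult lsubst_pow_one)

lemma lsubst_pow_prod: "n > 0 \<Longrightarrow> lsubst_pow n (prod f A) = (\<Prod>x\<in>A. lsubst_pow n (f x))"
  by (induction A rule: infinite_finite_induct) (simp_all add: lsubst_pow_mult lsubst_pow_one)

lemma lsubst_pow_lsubst_pow:
  "m > 0 \<Longrightarrow> n > 0 \<Longrightarrow> lsubst_pow m (lsubst_pow n p) = lsubst_pow (m * n) p"
  by (subst (2) lsubst_pow_def)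
     (simp add: lsubst_pow_sum lsubst_pow_single lsubst_pow_def[of "m * n"] mult.assoc)

text \<open>For \<open>n = 2\<close> the right-hand side is the subdivision rule with mask
  \<open>p\<close> and data \<open>g\<close>; for \<open>n = 2 ^ j\<close> it describes j steps at
  once.\<close>

lemma lookup_mult_lsubst_pow:
  assumes "n > 0"
  shows "lcoeff (p * lsubst_pow n g) k = (\<Sum>l\<in>Poly_Mapping.keys g. lcoeff g l * lcoeff p (k - int n * l))"
proof -
  have "p * lsubst_pow n g =
      (\<Sum>l\<in>Poly_Mapping.keys g. Poly_Mapping.single (int n * l) (lcoeff g l) * p)"
    by (simp add: lsubst_pow_def sum_distrib_left mult.commute)
  thus ?thesis by (simp add: lookup_sum lookup_single_mult)
qed

text \<open>The factor with index 0 is split off, not the last one: a subdivision step and a left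
  multiplication by the transfer matrix both multiply by b(z) after substituting z^2 in what came
  before.\<close>

lemma iterated_symbol_Suc: "iterated_symbol b (Suc j) = b * lsubst_pow 2 (iterated_symbol b j)"
proof -
  have "iterated_symbol b (Suc j) = lsubst_pow 1 b * (\<Prod>i<j. lsubst_pow (2 ^ Suc i) b)"
    by (simp add: iterated_symbol_def prod.lessThan_Suc_shift del: prod.lessThan_Suc)
  also have "lsubst_pow 1 b = b"
    by (rule poly_mapping_eqI) (simp add: lookup_lsubst_pow)
  also have "(\<Prod>i<j. lsubst_pow (2 ^ Suc i) b) = lsubst_pow 2 (iterated_symbol b j)"
    by (simp add: iterated_symbol_def lsubst_pow_prod lsubst_pow_lsubst_pow)
  finally show ?thesis .
qed

section \<open>Positivity\<close>

text \<open>Orthogonality of the characters of Z/N: the summands are the powers of one root of unity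
  \<open>w\<close>, and a geometric sum with \<open>w ^ N = 1\<close> vanishes unless
  \<open>w = 1\<close>.\<close>

lemma sum_cis_roots_of_unity:
  assumes "N > 0"
  shows "(\<Sum>n<N. cis (2 * pi * real n / real N) powi k) = (if int N dvd k then of_nat N else 0)"
proof -
  define w where "w = cis (2 * pi * of_int k / real N)"
  have w: "cis (2 * pi * real n / real N) powi k = w ^ n" for n
    by (simp only: w_def cis_power_int Complex.DeMoivre) (rule arg_cong[of _ _ cis], simp)
  have wN: "w ^ N = 1"
    using assms by (simp add: w_def Complex.DeMoivre)
  have w1: "w = 1 \<longleftrightarrow> int N dvd k"
  proof
    assume "w = 1"
    hence "cos (2 * pi * of_int k / real N) = 1"
      by (simp add: w_def complex_eq_iff)
    then obtain n :: int where "2 * pi * of_int k / real N = of_int n * 2 * pi"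
      by (auto simp: cos_one_2pi_int)
    hence "real_of_int k = of_int (int N * n)"
      using assms by (simp add: field_simps)
    hence "k = int N * n" by linarith
    thus "int N dvd k" by simp
  next
    assume "int N dvd k"
    then obtain n where "k = int N * n" by auto
    hence "2 * pi * of_int k / real N = 2 * pi * of_int n" using assms by simp
    thus "w = 1" unfolding w_def by (simp only: cis_multiple_2pi Ints_of_int)
  qed
  show ?thesis
  proof (cases "w = 1")
    case True
    thus ?thesis using w1 by (simp add: w)
  next
    case False
    thus ?thesis using w1 wN by (simp add: w sum_gp_strict)
  qed
qed

text \<open>Fourier inversion over the N-th roots of unity yields the sum of all coefficients at
  indices congruent to k modulo N. The width condition leaves only k itself, so a finite sum
  replaces the Fourier integral.\<close>

lemma lookup_eq_discrete_fourier:
  assumes "N > 0" "\<And>l. l \<in> Poly_Mapping.keys q \<Longrightarrow> \<bar>l - k\<bar> < int N"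
  shows "of_real (real N * lcoeff q k) =
    (\<Sum>n<N. leval q (cis (2 * pi * real n / real N)) * cis (2 * pi * real n / real N) powi (- k))"
proof -
  have "(\<Sum>n<N. leval q (cis (2 * pi * real n / real N)) * cis (2 * pi * real n / real N) powi (- k))
     = (\<Sum>n<N. \<Sum>l\<in>Poly_Mapping.keys q. of_real (lcoeff q l) *
          cis (2 * pi * real n / real N) powi (l - k))"
    unfolding leval_def sum_distrib_right
    by (intro sum.cong) (simp_all add: power_int_diff power_int_minus divide_inverse)
  also have "\<dots> = (\<Sum>l\<in>Poly_Mapping.keys q. of_real (lcoeff q l) *
          (if int N dvd l - k then of_nat N else 0))"
    by (subst sum.swap) (simp only: sum_distrib_left[symmetric] sum_cis_roots_of_unity[OF assms(1)])
  also have "\<dots> = (\<Sum>l\<in>Poly_Mapping.keys q. if l = k then of_real (real N * lcoeff q l) else 0)"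
  proof (rule sum.cong)
    fix l assume "l \<in> Poly_Mapping.keys q"
    hence "int N dvd l - k \<longleftrightarrow> l = k"
      using assms(2)[of l] dvd_imp_le_int[of "l - k" "int N"] by auto
    thus "of_real (lcoeff q l) * (if int N dvd l - k then of_nat N else 0) =
        (if l = k then complex_of_real (real N * lcoeff q l) else 0)" by simp
  qed simp
  also have "\<dots> = of_real (real N * lcoeff q k)"
    by (simp add: in_keys_iff)
  finally show ?thesis ..
qed

text \<open>Triangle inequality in the inversion formula: the phases at index k have modulus 1, and
  what remains is the inversion formula at index 0 because the values of \<open>q\<close> are
  nonnegative.\<close>

lemma abs_lookup_le_lookup_zero:
  assumes pos: "\<And>z. norm z = 1 \<Longrightarrow> leval q z \<in> \<real>\<^sub>\<ge>\<^sub>0"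
  shows "\<bar>lcoeff q k\<bar> \<le> lcoeff q 0"
proof -
  define m where "m = Max (insert 0 ((\<lambda>l. \<bar>l\<bar>) ` Poly_Mapping.keys q))"
  have m: "\<bar>l\<bar> \<le> m" if "l \<in> Poly_Mapping.keys q" for l
    unfolding m_def using that by (intro Max_ge) auto
  have m0: "0 \<le> m" unfolding m_def by (intro Max_ge) auto
  \<comment> \<open>Large enough for the support of \<open>q\<close> as seen from k and from 0, so
    the same nodes serve both inversions.\<close>
  define N where "N = nat (m + \<bar>k\<bar> + 1)"
  have N: "N > 0" "int N = m + \<bar>k\<bar> + 1" using m0 by (simp_all add: N_def)
  define w where "w n = cis (2 * pi * real n / real N)" for n
  have "real N * \<bar>lcoeff q k\<bar> = norm (complex_of_real (real N * lcoeff q k))"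
    by (simp only: norm_of_real abs_mult abs_of_nat)
  also have "\<dots> = norm (\<Sum>n<N. leval q (w n) * w n powi (- k))"
    unfolding w_def using N m by (subst lookup_eq_discrete_fourier) (force intro!: refl)+
  also have "\<dots> \<le> (\<Sum>n<N. norm (leval q (w n) * w n powi (- k)))"
    by (rule norm_sum)
  also have "\<dots> = (\<Sum>n<N. Re (leval q (w n)))"
  proof (rule sum.cong)
    fix n
    have "leval q (w n) \<in> \<real>\<^sub>\<ge>\<^sub>0" by (rule pos) (simp add: w_def)
    thus "norm (leval q (w n) * w n powi (- k)) = Re (leval q (w n))"
      by (auto simp: nonneg_Reals_def norm_mult norm_power_int w_def)
  qed simp
  also have "\<dots> = Re (\<Sum>n<N. leval q (w n) * w n powi (- 0))"
    by simp
  also have "\<dots> = Re (of_real (real N * lcoeff q 0))"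
    unfolding w_def using N m by (subst lookup_eq_discrete_fourier) (force intro!: refl)+
  also have "\<dots> = real N * lcoeff q 0" by simp
  finally show ?thesis using N(1) by simp
qed

text \<open>On the unit circle every factor is a value of \<open>b\<close> at another point of the
  circle, so the product is nonnegative there.\<close>

lemma abs_lookup_iterated_symbol_le:
  assumes pos: "\<And>z. norm z = 1 \<Longrightarrow> leval b z \<in> \<real>\<^sub>\<ge>\<^sub>0"
  shows "\<bar>lcoeff (iterated_symbol b j) k\<bar> \<le> lcoeff (iterated_symbol b j) 0"
proof (rule abs_lookup_le_lookup_zero)
  fix z :: complex assume z: "norm z = 1"
  hence "z \<noteq> 0" by auto
  hence "leval (iterated_symbol b j) z = (\<Prod>i<j. leval b (z ^ 2 ^ i))"
    by (simp add: iterated_symbol_def leval_prod leval_lsubst_pow)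
  moreover have "(\<Prod>i\<in>A. leval b (z ^ 2 ^ i)) \<in> \<real>\<^sub>\<ge>\<^sub>0" for A
    by (induction A rule: infinite_finite_induct)
       (auto simp: pos z norm_power intro!: nonneg_Reals_mult_I)
  ultimately show "leval (iterated_symbol b j) z \<in> \<real>\<^sub>\<ge>\<^sub>0" by simp
qed

lemma leval_nonneg_of_trig_symbol_nonneg:
  assumes supp: "\<And>k. \<bar>k\<bar> > int p \<Longrightarrow> lcoeff b k = 0"
    and sym: "\<And>k. lcoeff b (- k) = lcoeff b k"
    and pos: "\<And>\<xi>. \<xi> \<in> {- pi..pi} \<Longrightarrow> trig_symbol b p \<xi> \<ge> 0"
    and z: "norm z = 1"
  shows "leval b z \<in> \<real>\<^sub>\<ge>\<^sub>0"
proof -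
  \<comment> \<open>\<open>trig_symbol\<close> describes \<open>b\<close> at exp(-i xi), hence the
    angle \<open>- Arg z\<close>.\<close>
  have "z = exp (- \<i> * of_real (- Arg z))"
    using z cis_Arg[of z] by (cases "z = 0") (auto simp: cis_conv_exp sgn_div_norm)
  hence "leval b z = of_real (trig_symbol b p (- Arg z))"
    using leval_eq_trig_symbol[of p b "- Arg z", OF supp sym] by simp
  moreover have "- Arg z \<in> {- pi..pi}" using Arg_bounded[of z] by auto
  ultimately show ?thesis using pos by simp
qed

section \<open>Growth of matrix powers\<close>

lemma pow_mat_Suc_left:
  assumes A: "A \<in> carrier_mat n n"
  shows "A ^\<^sub>m Suc k = A * A ^\<^sub>m k"
proof (induction k)
  case 0
  show ?case using A by simp
next
  case (Suc k)
  have "A ^\<^sub>m Suc (Suc k) = A * A ^\<^sub>m k * A"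
    using Suc by simp
  also have "\<dots> = A * (A ^\<^sub>m k * A)"
    using A by (intro assoc_mult_mat[of _ n n _ n _ n]) auto
  finally show ?case by simp
qed

lemma pow_mat_smult:
  fixes c :: "'a :: comm_semiring_1"
  assumes A: "A \<in> carrier_mat n n"
  shows "(c \<cdot>\<^sub>m A) ^\<^sub>m k = c ^ k \<cdot>\<^sub>m A ^\<^sub>m k"
proof (induction k)
  case 0
  show ?case by (rule eq_matI) auto
next
  case (Suc k)
  have "(c \<cdot>\<^sub>m A) ^\<^sub>m Suc k = (c ^ k \<cdot>\<^sub>m A ^\<^sub>m k) * (c \<cdot>\<^sub>m A)"
    by (simp add: Suc)
  also have "\<dots> = c ^ Suc k \<cdot>\<^sub>m A ^\<^sub>m Suc k"
    using A
    by (simp add: mult_smult_distrib[of _ n n _ n] mult_smult_assoc_mat[of _ n n _ n])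
       (rule eq_matI, auto simp: mult_ac)
  finally show ?case .
qed

lemma spectral_radius_nonneg:
  assumes "A \<in> carrier_mat n n" "n > 0"
  shows "spectral_radius A \<ge> 0"
  using spectral_radius_mem_max(1)[OF assms] by auto

text \<open>Scaling by 1/c brings the spectral radius below 1, where the Jordan normal form gives
  bounded powers.\<close>

lemma power_bound_of_spectral_radius_less:
  assumes A: "A \<in> carrier_mat n n" and n: "n > 0" and c: "spectral_radius A < c"
  shows "\<exists>C. \<forall>k. norm_bound (A ^\<^sub>m k) (C * c ^ k)"
proof -
  have c0: "c > 0" using spectral_radius_nonneg[OF A n] c by simp
  define B where "B = (of_real (1 / c) :: complex) \<cdot>\<^sub>m A"
  have B: "B \<in> carrier_mat n n" using A by (simp add: B_def)
  have "spectral_radius B < 1"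
  proof -
    obtain x v where x: "spectral_radius B = norm x" and v: "eigenvector B v x"
      using spectral_radius_mem_max(1)[OF B n] by (auto simp: spectrum_def eigenvalue_def)
    have "A *\<^sub>v v = (of_real c * x) \<cdot>\<^sub>v v"
    proof (rule eq_vecI)
      fix i assume "i < dim_vec ((of_real c * x) \<cdot>\<^sub>v v)"
      hence i: "i < n" using v B by (auto simp: eigenvector_def)
      have "(B *\<^sub>v v) $ i = (x \<cdot>\<^sub>v v) $ i" using v by (simp add: eigenvector_def)
      thus "(A *\<^sub>v v) $ i = ((of_real c * x) \<cdot>\<^sub>v v) $ i"
        using i A v B c0 by (auto simp: B_def eigenvector_def field_simps)
    qed (use A B v in \<open>auto simp: eigenvector_def\<close>)
    hence "eigenvector A v (of_real c * x)"
      using v A B by (auto simp: eigenvector_def)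
    hence "norm (of_real c * x) \<in> norm ` spectrum A"
      unfolding spectrum_def eigenvalue_def by blast
    hence "norm (of_real c * x) \<le> spectral_radius A"
      by (rule spectral_radius_mem_max(2)[OF A n])
    hence "c * norm x \<le> spectral_radius A" using c0 by (simp add: norm_mult)
    hence "c * norm x < c * 1" using c by linarith
    thus ?thesis using c0 by (simp only: x mult_less_cancel_left_pos)
  qed
  then obtain C where C: "\<And>k. norm_bound (B ^\<^sub>m k) C"
    using spectral_radius_jnf_norm_bound_less_1_upper_triangular[OF B] by blast
  have "norm_bound (A ^\<^sub>m k) (C * c ^ k)" for k
  proof (rule norm_boundI)
    fix i j assume "i < dim_row (A ^\<^sub>m k)" "j < dim_col (A ^\<^sub>m k)"
    hence ij: "i < n" "j < n" using pow_mat_dim_square[OF A, of k] by simp_all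
    have "norm ((B ^\<^sub>m k) $$ (i, j)) \<le> C"
      using C[of k] ij B by (auto simp: norm_bound_def)
    also have "(B ^\<^sub>m k) $$ (i, j) = of_real (1 / c) ^ k * (A ^\<^sub>m k) $$ (i, j)"
      unfolding B_def pow_mat_smult[OF A] using ij A by simp
    finally show "norm ((A ^\<^sub>m k) $$ (i, j)) \<le> C * c ^ k"
      using c0 by (simp add: norm_mult norm_power norm_divide field_simps)
  qed
  thus ?thesis by blast
qed

text \<open>Apply the k-th power to an eigenvector whose eigenvalue has maximal modulus and read off
  the coordinate of largest modulus; the factor n counts the terms of one row.\<close>

lemma spectral_radius_power_le:
  assumes A: "A \<in> carrier_mat n n" and n: "n > 0" and bound: "norm_bound (A ^\<^sub>m k) C"
  shows "spectral_radius A ^ k \<le> real n * C"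
proof -
  obtain x v where x: "spectral_radius A = norm x" and v: "eigenvector A v x"
    using spectral_radius_mem_max(1)[OF A n] by (auto simp: spectrum_def eigenvalue_def)
  have vn: "v \<in> carrier_vec n" "v \<noteq> 0\<^sub>v n" using v A by (auto simp: eigenvector_def)
  define m where "m = Max ((\<lambda>i. norm (v $ i)) ` {..<n})"
  have le_m: "norm (v $ i) \<le> m" if "i < n" for i
    unfolding m_def using that by (intro Max_ge) auto
  have "m \<in> (\<lambda>i. norm (v $ i)) ` {..<n}"
    unfolding m_def using n by (intro Max_in) auto
  then obtain i where i: "i < n" "m = norm (v $ i)" by auto
  have "m > 0"
  proof (rule ccontr)
    assume "\<not> m > 0"
    hence "v $ i = 0" if "i < n" for i
      using order_trans[OF norm_ge_zero le_m[OF that]] le_m[OF that] by simp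
    hence "v = 0\<^sub>v n" using vn by (intro eq_vecI) auto
    thus False using vn by simp
  qed
  have "norm x ^ k * m = norm ((A ^\<^sub>m k *\<^sub>v v) $ i)"
    unfolding eigenvector_pow[OF A v] using i vn by (simp add: norm_mult norm_power)
  also have "(A ^\<^sub>m k *\<^sub>v v) $ i = (\<Sum>j<n. (A ^\<^sub>m k) $$ (i, j) * v $ j)"
    using i vn A by (simp add: scalar_prod_def atLeast0LessThan)
  also have "norm \<dots> \<le> (\<Sum>j<n. norm ((A ^\<^sub>m k) $$ (i, j) * v $ j))"
    by (rule norm_sum)
  also have "\<dots> \<le> (\<Sum>j<n. C * m)"
  proof (rule sum_mono)
    fix j assume "j \<in> {..<n}"
    hence "norm ((A ^\<^sub>m k) $$ (i, j)) \<le> C" "norm (v $ j) \<le> m"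
      using bound i A le_m by (auto simp: norm_bound_def)
    thus "norm ((A ^\<^sub>m k) $$ (i, j) * v $ j) \<le> C * m"
      unfolding norm_mult using order_trans[OF norm_ge_zero] by (intro mult_mono) auto
  qed
  also have "\<dots> = real n * C * m" by simp
  finally show ?thesis using \<open>m > 0\<close> by (simp add: x)
qed

text \<open>The two hypotheses say that \<open>B k\<close> is the maximum norm of the k-th power. It
  lies between multiples of the k-th powers of the spectral radius and of any larger c, and the k-th
  roots of the constants tend to 1.\<close>

lemma root_tendsto_spectral_radius:
  assumes A: "A \<in> carrier_mat n n" and n: "n > 0"
    and bound: "\<And>k. norm_bound (A ^\<^sub>m k) (B k)"
    and entry: "\<And>k. \<exists>i<n. \<exists>j<n. B k \<le> norm ((A ^\<^sub>m k) $$ (i, j))"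
  shows "(\<lambda>k. root k (B k)) \<longlonglongrightarrow> spectral_radius A"
proof (rule order_tendstoI)
  let ?\<rho> = "spectral_radius A"
  have \<rho>0: "?\<rho> \<ge> 0" by (rule spectral_radius_nonneg[OF A n])
  {
    fix u assume "u < ?\<rho>"
    have "(\<lambda>k. root k (1 / real n) * ?\<rho>) \<longlonglongrightarrow> 1 * ?\<rho>"
      using n by (intro tendsto_intros LIMSEQ_root_const) auto
    hence "eventually (\<lambda>k. u < root k (1 / real n) * ?\<rho>) sequentially"
      using \<open>u < ?\<rho>\<close> by (intro order_tendstoD) auto
    thus "eventually (\<lambda>k. u < root k (B k)) sequentially"
      \<comment> \<open>Excludes \<open>k = 0\<close>, where \<open>root\<close> takes the default
        value 0.\<close>
      using eventually_gt_at_top[of 0]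
    proof eventually_elim
      case (elim k)
      have "root k (1 / real n) * ?\<rho> = root k (1 / real n * ?\<rho> ^ k)"
        using elim \<rho>0 by (simp only: real_root_mult real_root_power_cancel)
      also have "\<dots> \<le> root k (B k)"
        using spectral_radius_power_le[OF A n bound[of k]] elim n
        by (intro real_root_le_mono) (auto simp: field_simps)
      finally show ?case using elim by simp
    qed
  }
  {
    fix u assume "?\<rho> < u"
    then obtain c where c: "?\<rho> < c" "c < u" using dense by blast
    obtain C where C: "\<And>k. norm_bound (A ^\<^sub>m k) (C * c ^ k)"
      using power_bound_of_spectral_radius_less[OF A n c(1)] by blast
    \<comment> \<open>\<open>max 1 C\<close> is positive, as the convergence of its k-th roots to 1
      requires.\<close>
    have le: "B k \<le> max 1 C * c ^ k" for k
    proof -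
      obtain i j where ij: "i < n" "j < n" and Bk: "B k \<le> norm ((A ^\<^sub>m k) $$ (i, j))"
        using entry by blast
      note Bk
      also have "\<dots> \<le> C * c ^ k" using C[of k] ij A by (auto simp: norm_bound_def)
      also have "\<dots> \<le> max 1 C * c ^ k" using c \<rho>0 by (intro mult_right_mono) auto
      finally show ?thesis .
    qed
    have "(\<lambda>k. root k (max 1 C) * c) \<longlonglongrightarrow> 1 * c"
      by (intro tendsto_intros LIMSEQ_root_const) auto
    hence "eventually (\<lambda>k. root k (max 1 C) * c < u) sequentially"
      using c by (intro order_tendstoD) auto
    thus "eventually (\<lambda>k. root k (B k) < u) sequentially"
      using eventually_gt_at_top[of 0]
    proof eventually_elim
      case (elim k)
      have "root k (B k) \<le> root k (max 1 C * c ^ k)"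
        using elim le by (intro real_root_le_mono) auto
      also have "\<dots> = root k (max 1 C) * c"
        using elim c \<rho>0 by (simp add: real_root_mult real_root_power_cancel)
      finally show ?case using elim by simp
    qed
  }
qed

section \<open>The transfer matrix\<close>

lemma lookup_mult_lsubst_pow_superset:
  assumes "n > 0" "finite K" "\<And>l. l \<notin> K \<Longrightarrow> lcoeff g l * lcoeff p (k - int n * l) = 0"
  shows "lcoeff (p * lsubst_pow n g) k = (\<Sum>l\<in>K. lcoeff g l * lcoeff p (k - int n * l))"
  unfolding lookup_mult_lsubst_pow[OF assms(1)] using assms
  by (intro sum.mono_neutral_cong) (auto simp: in_keys_iff)

lemma symbol_mat_carrier: "symbol_mat b p \<in> carrier_mat (2 * p - 1) (2 * p - 1)"
  by (simp add: symbol_mat_def)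

text \<open>The matrix represents q(z) -> b(z) q(z^2), restricted to the coefficients with index in
  {-p+1..p-1}. These depend only on the coefficients of q in the same range, so powers of the matrix
  represent iterates of the operator.\<close>

lemma symbol_mat_pow:
  assumes supp: "\<And>k. \<bar>k\<bar> > int p \<Longrightarrow> lcoeff b k = 0"
    and ij: "i < 2 * p - 1" "j < 2 * p - 1"
  shows "(symbol_mat b p ^\<^sub>m n) $$ (i, j) =
    lcoeff (iterated_symbol b n) ((int i - int p + 1) - 2 ^ n * (int j - int p + 1))"
  using ij
proof (induction n arbitrary: i j)
  case 0
  thus ?case by (auto simp: symbol_mat_def iterated_symbol_def lookup_one when_def)
next
  case (Suc n)
  let ?M = "symbol_mat b p" and ?N = "2 * p - 1" and ?b = "iterated_symbol b n"
  define c where "c i = int i - int p + 1" for i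
  \<comment> \<open>By the induction hypothesis the coefficients of \<open>q\<close> at the points
    \<open>c m\<close> form column j of the n-th power.\<close>
  define q where "q = Poly_Mapping.single (2 ^ n * c j) 1 * ?b"
  have q: "lcoeff q m = lcoeff ?b (m - 2 ^ n * c j)" for m
    by (simp add: q_def lookup_single_mult)
  have "(?M ^\<^sub>m Suc n) $$ (i, j) = (?M * ?M ^\<^sub>m n) $$ (i, j)"
    by (simp only: pow_mat_Suc_left[OF symbol_mat_carrier])
  also have "\<dots> = (\<Sum>m<?N. ?M $$ (i, m) * (?M ^\<^sub>m n) $$ (m, j))"
    using Suc.prems pow_carrier_mat[OF symbol_mat_carrier, of b p n] symbol_mat_carrier[of b p]
    by (simp add: scalar_prod_def atLeast0LessThan)
  also have "\<dots> = (\<Sum>m<?N. lcoeff q (c m) * lcoeff b (c i - int 2 * c m))"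
    using Suc by (intro sum.cong) (simp_all add: symbol_mat_def q c_def)
  also have "\<dots> = (\<Sum>l\<in>c ` {..<?N}. lcoeff q l * lcoeff b (c i - int 2 * l))"
    by (subst sum.reindex) (auto simp: inj_on_def c_def)
  also have "\<dots> = lcoeff (b * lsubst_pow 2 q) (c i)"
  proof (rule lookup_mult_lsubst_pow_superset[symmetric])
    fix l assume l: "l \<notin> c ` {..<?N}"
    \<comment> \<open>Cutting the sum loses nothing: |l| >= p and |c i| <= p - 1 give |c i - 2 l| >=
      p + 1, outside the support of \<open>b\<close>.\<close>
    have "\<bar>l\<bar> \<ge> int p"
    proof (rule ccontr)
      assume "\<not> \<bar>l\<bar> \<ge> int p"
      hence "l = c (nat (l + int p - 1))" "nat (l + int p - 1) < ?N"
        by (auto simp: c_def)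
      thus False using l by blast
    qed
    moreover have "\<bar>c i\<bar> \<le> int p - 1" using Suc.prems by (auto simp: c_def)
    ultimately have "\<bar>c i - int 2 * l\<bar> > int p" by auto
    thus "lcoeff q l * lcoeff b (c i - int 2 * l) = 0" using supp by simp
  qed simp_all
  also have "b * lsubst_pow 2 q = Poly_Mapping.single (2 * (2 ^ n * c j)) 1 * iterated_symbol b (Suc n)"
    by (simp add: q_def lsubst_pow_mult lsubst_pow_single iterated_symbol_Suc mult.left_commute)
  also have "lcoeff \<dots> (c i) = lcoeff (iterated_symbol b (Suc n)) (c i - 2 ^ Suc n * c j)"
    unfolding lookup_single_mult by (simp add: mult.assoc)
  finally show ?case by (simp only: c_def)
qed

lemma complex_symbol_mat_carrier:
  "map_mat complex_of_real (symbol_mat b p) \<in> carrier_mat (2 * p - 1) (2 * p - 1)"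
  by (simp add: symbol_mat_def)

lemma complex_symbol_mat_pow:
  assumes supp: "\<And>k. \<bar>k\<bar> > int p \<Longrightarrow> lcoeff b k = 0"
    and ij: "i < 2 * p - 1" "j < 2 * p - 1"
  shows "(map_mat complex_of_real (symbol_mat b p) ^\<^sub>m n) $$ (i, j) = of_real
    (lcoeff (iterated_symbol b n) ((int i - int p + 1) - 2 ^ n * (int j - int p + 1)))"
proof -
  have "map_mat complex_of_real (symbol_mat b p) ^\<^sub>m n = map_mat complex_of_real (symbol_mat b p ^\<^sub>m n)"
    by (rule of_real_hom.mat_hom_pow[symmetric, OF symbol_mat_carrier])
  moreover have "dim_row (symbol_mat b p ^\<^sub>m n) = 2 * p - 1"
    "dim_col (symbol_mat b p ^\<^sub>m n) = 2 * p - 1"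
    by (simp_all add: symbol_mat_def)
  ultimately show ?thesis using ij symbol_mat_pow[OF supp ij] by simp
qed

context
  fixes b :: laurent and p :: nat
  assumes p: "p \<ge> 1"
    and supp: "\<And>k. \<bar>k\<bar> > int p \<Longrightarrow> lcoeff b k = 0"
    and pos: "\<And>z. norm z = 1 \<Longrightarrow> leval b z \<in> \<real>\<^sub>\<ge>\<^sub>0"
begin

lemma root_iterated_symbol_tendsto:
  "(\<lambda>j. root j (lcoeff (iterated_symbol b j) 0)) \<longlonglongrightarrow> real_spectral_radius (symbol_mat b p)"
  unfolding real_spectral_radius_def
proof (rule root_tendsto_spectral_radius)
  show "map_mat complex_of_real (symbol_mat b p) \<in> carrier_mat (2 * p - 1) (2 * p - 1)"
    by (rule complex_symbol_mat_carrier)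
  show "2 * p - 1 > 0" using p by simp
  fix n
  show "norm_bound (map_mat complex_of_real (symbol_mat b p) ^\<^sub>m n) (lcoeff (iterated_symbol b n) 0)"
  proof (rule norm_boundI)
    fix i j
    assume "i < dim_row (map_mat complex_of_real (symbol_mat b p) ^\<^sub>m n)"
      "j < dim_col (map_mat complex_of_real (symbol_mat b p) ^\<^sub>m n)"
    hence "i < 2 * p - 1" "j < 2 * p - 1"
      by (auto simp: symbol_mat_def split: if_splits)
    thus "norm ((map_mat complex_of_real (symbol_mat b p) ^\<^sub>m n) $$ (i, j)) \<le>
        lcoeff (iterated_symbol b n) 0"
      using abs_lookup_iterated_symbol_le[of b, OF pos] complex_symbol_mat_pow[OF supp] by simp
  qed
  \<comment> \<open>The shifted index p - 1 stands for 0, so this entry is the central coefficient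
    for every n.\<close>
  have "norm ((map_mat complex_of_real (symbol_mat b p) ^\<^sub>m n) $$ (p - 1, p - 1)) =
      \<bar>lcoeff (iterated_symbol b n) 0\<bar>"
    using p by (subst complex_symbol_mat_pow[OF supp]) auto
  thus "\<exists>i<2 * p - 1. \<exists>j<2 * p - 1. lcoeff (iterated_symbol b n) 0
      \<le> norm ((map_mat complex_of_real (symbol_mat b p) ^\<^sub>m n) $$ (i, j))"
    using p by (intro exI[of _ "p - 1"] conjI) auto
qed

text \<open>The matrix estimate is taken at the central entry alone; positivity carries it to all
  coefficients, also to those that are not entries of the matrix power.\<close>

lemma iterated_symbol_bound:
  assumes "real_spectral_radius (symbol_mat b p) < c"
  shows "\<exists>C. \<forall>n k. \<bar>lcoeff (iterated_symbol b n) k\<bar> \<le> C * c ^ n"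
proof -
  obtain C where C: "\<And>n. norm_bound (map_mat complex_of_real (symbol_mat b p) ^\<^sub>m n) (C * c ^ n)"
    using power_bound_of_spectral_radius_less[OF complex_symbol_mat_carrier, of p b c] assms p
    unfolding real_spectral_radius_def by auto
  have "\<bar>lcoeff (iterated_symbol b n) k\<bar> \<le> C * c ^ n" for n k
  proof -
    have "norm ((map_mat complex_of_real (symbol_mat b p) ^\<^sub>m n) $$ (p - 1, p - 1)) \<le> C * c ^ n"
      using C[of n] p unfolding norm_bound_def pow_mat_dim_square[OF complex_symbol_mat_carrier]
      by auto
    hence "\<bar>lcoeff (iterated_symbol b n) 0\<bar> \<le> C * c ^ n"
      using p by (subst (asm) complex_symbol_mat_pow[OF supp]) auto
    thus ?thesis using abs_lookup_iterated_symbol_le[of b n k, OF pos] by linarith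
  qed
  thus ?thesis by blast
qed

end

section \<open>Limits of dyadic step functions\<close>

text \<open>The dyadic cell of x at level j + 1 lies in its cell at level j, whose index is obtained
  by halving.\<close>

lemma floor_double_div_2: "\<lfloor>2 ^ Suc j * x\<rfloor> div 2 = \<lfloor>2 ^ j * x :: real\<rfloor>"
  using floor_divide_real_eq_div[of 2 "2 ^ Suc j * x"] by simp

text \<open>Along the nested cells around x the increments are dominated by a geometric series; its
  tail from j on is the stated error.\<close>

lemma dyadic_step_limit:
  fixes g :: "nat \<Rightarrow> int \<Rightarrow> real"
  assumes \<theta>: "0 < \<theta>" "\<theta> < 1"
    and refine: "\<And>j k. \<bar>g (Suc j) k - g j (k div 2)\<bar> \<le> C * \<theta> ^ j"
  obtains G :: "real \<Rightarrow> real" where "\<And>j x. \<bar>g j \<lfloor>2 ^ j * x\<rfloor> - G x\<bar> \<le> C / (1 - \<theta>) * \<theta> ^ j"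
proof
  fix j :: nat and x :: real
  define S where "S j = g j \<lfloor>2 ^ j * x\<rfloor>" for j
  define d where "d j = S (Suc j) - S j" for j
  have d: "norm (d i) \<le> C * \<theta> ^ i" for i
    using refine[of i "\<lfloor>2 ^ Suc i * x\<rfloor>"] unfolding floor_double_div_2
    by (simp add: d_def S_def del: power_Suc)
  have gs: "(\<lambda>i. C * \<theta> ^ (i + j)) sums (C / (1 - \<theta>) * \<theta> ^ j)"
    using sums_mult[OF geometric_sums[of \<theta>], of "C * \<theta> ^ j"] \<theta> by (simp add: power_add mult_ac)
  have sm: "summable d"
    by (rule summable_comparison_test'[OF _ d])
       (use \<theta> in \<open>auto intro!: summable_mult summable_geometric\<close>)
  have "S j - (S 0 + suminf d) = - suminf (\<lambda>i. d (i + j))"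
    unfolding suminf_split_initial_segment[OF sm, of j] d_def
    by (simp add: sum_lessThan_telescope)
  moreover have "norm (suminf (\<lambda>i. d (i + j))) \<le> suminf (\<lambda>i. C * \<theta> ^ (i + j))"
    using gs by (intro norm_suminf_le d) (auto simp: sums_iff)
  \<comment> \<open>The witness for \<open>G x\<close> is \<open>S 0 + suminf d\<close>, spelled out
    because \<open>S\<close> and \<open>d\<close> are local to the fixed x.\<close>
  ultimately show "\<bar>g j \<lfloor>2 ^ j * x\<rfloor> - (g 0 \<lfloor>2 ^ 0 * x\<rfloor> + suminf (\<lambda>i. g (Suc i) \<lfloor>2 ^ Suc i * x\<rfloor> - g i \<lfloor>2 ^ i * x\<rfloor>))\<bar>
      \<le> C / (1 - \<theta>) * \<theta> ^ j"
    using gs by (simp add: S_def d_def[abs_def] sums_iff)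
qed

text \<open>\<open>g j k\<close> is read as the value of a step function on the cell [k/2^j,
  (k+1)/2^j). Later \<open>g\<close> is a divided difference of the scheme, with one common \<theta>
  for all orders.\<close>

locale dyadic_step_approx =
  fixes g :: "nat \<Rightarrow> int \<Rightarrow> real" and G :: "real \<Rightarrow> real" and K \<theta> :: real
  assumes \<theta>: "0 < \<theta>" "\<theta> < 1"
    and approx: "\<And>j x. \<bar>g j \<lfloor>2 ^ j * x\<rfloor> - G x\<bar> \<le> K * \<theta> ^ j"
begin

lemma K_nonneg: "K \<ge> 0"
  using order_trans[OF abs_ge_zero approx[of 0 0]] by simp

lemma error_tendsto_0: "(\<lambda>j. C * \<theta> ^ j) \<longlonglongrightarrow> 0"
  using tendsto_mult[OF tendsto_const LIMSEQ_power_zero[of \<theta>]] \<theta> by auto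

lemma step_tendsto: "(\<lambda>j. g j \<lfloor>2 ^ j * x\<rfloor>) \<longlonglongrightarrow> G x"
  by (rule LIM_zero_cancel, rule Lim_null_comparison[OF _ error_tendsto_0[of K]]) (simp add: approx)

text \<open>Linear interpolation moves the step function by at most one difference of neighbours,
  which tends to 0.\<close>

lemma piecewise_linear_tendsto:
  assumes diff: "\<And>j k. \<bar>g j k - g j (k - 1)\<bar> \<le> C * \<theta> ^ j"
  shows "(\<lambda>j. (1 - frac (2 ^ j * x)) * g j \<lfloor>2 ^ j * x\<rfloor>
    + frac (2 ^ j * x) * g j (\<lfloor>2 ^ j * x\<rfloor> + 1)) \<longlonglongrightarrow> G x" (is "?L \<longlonglongrightarrow> _")
proof -
  have "norm (?L j - g j \<lfloor>2 ^ j * x\<rfloor>) \<le> C * \<theta> ^ j" for j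
  proof -
    have "?L j - g j \<lfloor>2 ^ j * x\<rfloor> = frac (2 ^ j * x) * (g j (\<lfloor>2 ^ j * x\<rfloor> + 1) - g j \<lfloor>2 ^ j * x\<rfloor>)"
      by (simp add: algebra_simps)
    also have "norm \<dots> \<le> 1 * (C * \<theta> ^ j)"
      unfolding norm_mult using diff[of j "\<lfloor>2 ^ j * x\<rfloor> + 1"] frac_lt_1[of "2 ^ j * x"]
      by (intro mult_mono) auto
    finally show ?thesis by simp
  qed
  hence "(\<lambda>j. ?L j - g j \<lfloor>2 ^ j * x\<rfloor>) \<longlonglongrightarrow> 0"
    by (intro Lim_null_comparison[OF _ error_tendsto_0[of C]] always_eventually) blast
  from tendsto_add[OF this step_tendsto[of x]] show ?thesis by simp
qed

lemma limit_bounded: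
  assumes "\<And>k. \<bar>g 0 k\<bar> \<le> B"
  shows "\<bar>G x\<bar> \<le> B + K"
  using assms[of "\<lfloor>x\<rfloor>"] approx[of 0 x] by simp

text \<open>Two close points are compared at the level whose cells are about as long as their
  distance, where they lie in equal or adjacent cells. For distant points boundedness
  suffices.\<close>

lemma limit_hoelder:
  assumes \<theta>_eq: "\<theta> = 2 powr (- \<alpha>)"
    and bounded: "\<And>k. \<bar>g 0 k\<bar> \<le> B"
    and diff: "\<And>j k. \<bar>g j k - g j (k - 1)\<bar> \<le> C * \<theta> ^ j"
  shows "hoelder_continuous \<alpha> G"
proof -
  have \<alpha>: "\<alpha> > 0" using \<theta>(2) ge_one_powr_ge_zero[of 2 "- \<alpha>"] unfolding \<theta>_eq by linarith
  have C0: "C \<ge> 0" using order_trans[OF abs_ge_zero diff[of 0 0]] by simp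
  have B0: "B \<ge> 0" using order_trans[OF abs_ge_zero bounded[of 0]] by simp
  \<comment> \<open>One summand for each case. The factor \<open>2 powr \<alpha>\<close> pays for |x
    - y| possibly being as small as half a cell.\<close>
  define L where "L = (2 * K + C) * 2 powr \<alpha> + 2 * (B + K)"
  have L1: "(2 * K + C) * 2 powr \<alpha> \<le> L" and L2: "2 * (B + K) \<le> L"
    using K_nonneg C0 B0 by (auto simp: L_def)
  have "\<bar>G x - G y\<bar> \<le> L * \<bar>x - y\<bar> powr \<alpha>" for x y
  proof (cases "x = y")
    case True
    thus ?thesis by simp
  next
    case False
    hence xy: "\<bar>x - y\<bar> > 0" by simp
    show ?thesis
    proof (cases "\<bar>x - y\<bar> \<le> 1")
      case True
      \<comment> \<open>\<open>2^(-j-1) < \<bar>x - y\<bar> \<le> 2^(-j)\<close>\<close>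
      define j where "j = nat \<lfloor>- log 2 \<bar>x - y\<bar>\<rfloor>"
      have "log 2 \<bar>x - y\<bar> \<le> 0" using True xy by simp
      hence j: "real j \<le> - log 2 \<bar>x - y\<bar>" "- log 2 \<bar>x - y\<bar> < real j + 1"
        unfolding j_def by linarith+
      have "2 ^ j * \<bar>x - y\<bar> = 2 powr (real j + log 2 \<bar>x - y\<bar>)"
        using xy by (simp add: powr_add powr_realpow)
      also have "\<dots> \<le> 2 powr 0" using j by (intro powr_mono) auto
      finally have "\<bar>2 ^ j * x - 2 ^ j * y\<bar> \<le> 1"
        by (simp add: abs_mult flip: right_diff_distrib)
      hence "\<lfloor>2 ^ j * x\<rfloor> = \<lfloor>2 ^ j * y\<rfloor> \<or> \<lfloor>2 ^ j * x\<rfloor> - 1 = \<lfloor>2 ^ j * y\<rfloor> \<or> \<lfloor>2 ^ j * y\<rfloor> - 1 = \<lfloor>2 ^ j * x\<rfloor>"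
        by linarith
      hence "\<bar>g j \<lfloor>2 ^ j * x\<rfloor> - g j \<lfloor>2 ^ j * y\<rfloor>\<bar> \<le> C * \<theta> ^ j"
        using diff[of j "\<lfloor>2 ^ j * x\<rfloor>"] diff[of j "\<lfloor>2 ^ j * y\<rfloor>"] C0 \<theta>
        by (elim disjE) (auto simp: abs_minus_commute)
      hence "\<bar>G x - G y\<bar> \<le> (2 * K + C) * \<theta> ^ j"
        using approx[of j x] approx[of j y] by (simp add: ring_distribs)
      also have "\<dots> \<le> (2 * K + C) * (2 powr \<alpha> * \<bar>x - y\<bar> powr \<alpha>)"
      proof (rule mult_left_mono)
        have "\<theta> ^ j = 2 powr (- \<alpha> * real j)"
          by (simp add: \<theta>_eq powr_powr flip: powr_realpow)
        also have "\<dots> \<le> 2 powr (\<alpha> + \<alpha> * log 2 \<bar>x - y\<bar>)"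
        proof (rule powr_mono)
          have "\<alpha> * (- log 2 \<bar>x - y\<bar>) \<le> \<alpha> * (real j + 1)" using j \<alpha> by (intro mult_left_mono) auto
          thus "- \<alpha> * real j \<le> \<alpha> + \<alpha> * log 2 \<bar>x - y\<bar>" by (simp add: algebra_simps)
        qed simp
        also have "\<dots> = 2 powr \<alpha> * (2 powr log 2 \<bar>x - y\<bar>) powr \<alpha>"
          by (simp add: powr_add powr_powr mult.commute)
        also have "\<dots> = 2 powr \<alpha> * \<bar>x - y\<bar> powr \<alpha>" using xy by simp
        finally show "\<theta> ^ j \<le> 2 powr \<alpha> * \<bar>x - y\<bar> powr \<alpha>" .
      qed (use K_nonneg C0 in auto)
      also have "\<dots> \<le> L * \<bar>x - y\<bar> powr \<alpha>"
        using mult_right_mono[OF L1, of "\<bar>x - y\<bar> powr \<alpha>"] by (simp add: mult_ac)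
      finally show ?thesis .
    next
      case far: False
      have "\<bar>G x - G y\<bar> \<le> 2 * (B + K) * 1"
        using limit_bounded[of B x, OF bounded] limit_bounded[of B y, OF bounded] by simp
      also have "\<dots> \<le> L * \<bar>x - y\<bar> powr \<alpha>"
        using far \<alpha> L2 B0 K_nonneg by (intro mult_mono) (auto simp: ge_one_powr_ge_zero)
      finally show ?thesis .
    qed
  qed
  thus ?thesis unfolding hoelder_continuous_def by blast
qed

end

section \<open>Continuity and differentiation of the limits\<close>

lemma hoelder_continuous_imp_continuous:
  assumes "hoelder_continuous \<alpha> f" "\<alpha> > 0"
  shows "continuous_on UNIV f"
proof -
  obtain C where C: "\<And>x y. \<bar>f x - f y\<bar> \<le> C * \<bar>x - y\<bar> powr \<alpha>"
    using assms(1) unfolding hoelder_continuous_def by blast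
  have "(f \<longlongrightarrow> f x) (at x)" for x
  proof (rule LIM_zero_cancel, rule Lim_null_comparison)
    show "eventually (\<lambda>y. norm (f y - f x) \<le> C * \<bar>y - x\<bar> powr \<alpha>) (at x)"
      using C by (intro always_eventually) auto
    have "((\<lambda>y. \<bar>y - x\<bar> powr \<alpha>) \<longlongrightarrow> 0) (at x)"
      using assms(2) by (rule_tac tendsto_zero_powrI) (auto intro!: tendsto_eq_intros)
    thus "((\<lambda>y. C * \<bar>y - x\<bar> powr \<alpha>) \<longlongrightarrow> 0) (at x)"
      using tendsto_mult_right_zero by blast
  qed
  thus ?thesis by (simp add: continuous_on_def)
qed

lemma dyadic_floor_tendsto: "(\<lambda>j. of_int \<lfloor>2 ^ j * x\<rfloor> / 2 ^ j) \<longlonglongrightarrow> (x :: real)"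
proof (rule LIM_zero_cancel, rule Lim_null_comparison)
  have "\<bar>of_int \<lfloor>2 ^ j * x\<rfloor> / 2 ^ j - x\<bar> \<le> (1 / 2) ^ j" for j
  proof -
    have "of_int \<lfloor>2 ^ j * x\<rfloor> / 2 ^ j - x = (of_int \<lfloor>2 ^ j * x\<rfloor> - 2 ^ j * x) / 2 ^ j"
      by (simp add: field_simps)
    also have "\<bar>\<dots>\<bar> \<le> 1 / 2 ^ j"
      unfolding abs_divide by (intro divide_mono) (auto, linarith)
    finally show ?thesis by (simp add: power_divide)
  qed
  thus "eventually (\<lambda>j. norm (of_int \<lfloor>2 ^ j * x\<rfloor> / 2 ^ j - x) \<le> (1 / 2) ^ j) sequentially" by simp
  show "(\<lambda>j. (1 / 2 :: real) ^ j) \<longlonglongrightarrow> 0" by (intro LIMSEQ_power_zero) simp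
qed

text \<open>A discrete mean value inequality on a grid of spacing 1/s, by summing the error of each
  cell.\<close>

lemma increment_bound_of_difference_bound:
  fixes h h' :: "int \<Rightarrow> real"
  assumes h': "\<And>n. h' n = s * (h n - h (n - 1))" and s: "s > 0"
    and kl: "k \<le> l" and bound: "\<And>n. k < n \<Longrightarrow> n \<le> l \<Longrightarrow> \<bar>h' n - c\<bar> \<le> E"
  shows "\<bar>h l - h k - (of_int l / s - of_int k / s) * c\<bar> \<le> (of_int l / s - of_int k / s) * E"
  using kl bound
proof (induction l rule: int_ge_induct)
  case base
  show ?case by simp
next
  case (step l)
  have IH: "\<bar>h l - h k - (of_int l / s - of_int k / s) * c\<bar> \<le> (of_int l / s - of_int k / s) * E"
    using step by auto
  have "\<bar>h' (l + 1) - c\<bar> \<le> E" using step by auto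
  hence "\<bar>h' (l + 1) - c\<bar> / s \<le> E / s" using s by (simp add: divide_right_mono)
  moreover have "h (l + 1) - h l - c / s = (h' (l + 1) - c) / s"
    using s by (simp add: h' field_simps)
  ultimately have "\<bar>h (l + 1) - h l - c / s\<bar> \<le> E / s" using s by (simp add: abs_divide)
  with IH have "\<bar>h l - h k - (of_int l / s - of_int k / s) * c\<bar> + \<bar>h (l + 1) - h l - c / s\<bar>
      \<le> (of_int l / s - of_int k / s) * E + E / s" by (rule add_mono)
  moreover have "h (l + 1) - h k - (of_int (l + 1) / s - of_int k / s) * c =
      (h l - h k - (of_int l / s - of_int k / s) * c) + (h (l + 1) - h l - c / s)"
    by (simp add: add_divide_distrib ring_distribs)
  moreover have "(of_int l / s - of_int k / s) * E + E / s = (of_int (l + 1) / s - of_int k / s) * E"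
    by (simp add: add_divide_distrib ring_distribs)
  ultimately show ?case by (metis abs_triangle_ineq order_trans)
qed

text \<open>The discrete mean value inequality survives the limit j -> infinity; with
  \<open>c = G' x\<close> and continuity of \<open>G'\<close> at x it is the definition of the
  derivative.\<close>

lemma dyadic_step_limit_has_derivative:
  assumes "dyadic_step_approx g G K \<theta>" "dyadic_step_approx g' G' K' \<theta>"
    and g': "\<And>j k. g' j k = 2 ^ j * (g j k - g j (k - 1))"
    and cont: "continuous_on UNIV G'"
  shows "(G has_real_derivative G' x) (at x)"
proof -
  interpret G: dyadic_step_approx g G K \<theta> by fact
  interpret G': dyadic_step_approx g' G' K' \<theta> by fact
  have incr: "\<bar>G y - G x - (y - x) * c\<bar> \<le> (y - x) * e"
    if xy: "x \<le> y" and e: "\<And>t. x \<le> t \<Longrightarrow> t \<le> y \<Longrightarrow> \<bar>G' t - c\<bar> \<le> e" for x y c e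
  proof (rule LIMSEQ_le)
    let ?d = "\<lambda>j. of_int \<lfloor>2 ^ j * y\<rfloor> / 2 ^ j - of_int \<lfloor>2 ^ j * x\<rfloor> / 2 ^ j"
    show "(\<lambda>j. \<bar>g j \<lfloor>2 ^ j * y\<rfloor> - g j \<lfloor>2 ^ j * x\<rfloor> - ?d j * c\<bar>) \<longlonglongrightarrow> \<bar>G y - G x - (y - x) * c\<bar>"
      by (intro tendsto_rabs tendsto_diff tendsto_mult tendsto_const G.step_tendsto dyadic_floor_tendsto)
    have "(\<lambda>j. ?d j * (K' * \<theta> ^ j + e)) \<longlonglongrightarrow> (y - x) * (0 + e)"
      by (intro tendsto_mult[OF tendsto_diff tendsto_add] tendsto_const G'.error_tendsto_0
          dyadic_floor_tendsto)
    thus "(\<lambda>j. ?d j * (K' * \<theta> ^ j + e)) \<longlonglongrightarrow> (y - x) * e" by simp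
    have "\<bar>g j \<lfloor>2 ^ j * y\<rfloor> - g j \<lfloor>2 ^ j * x\<rfloor> - ?d j * c\<bar> \<le> ?d j * (K' * \<theta> ^ j + e)" for j
    proof (rule increment_bound_of_difference_bound[of "g' j"])
      show "\<lfloor>2 ^ j * x\<rfloor> \<le> \<lfloor>2 ^ j * y\<rfloor>" using xy by (intro floor_mono) simp
      fix n assume n: "\<lfloor>2 ^ j * x\<rfloor> < n" "n \<le> \<lfloor>2 ^ j * y\<rfloor>"
      \<comment> \<open>Backward differences use only indices above the floor of 2^j x, so the
        points n/2^j stay in [x, y], where \<open>e\<close> applies.\<close>
      hence "2 ^ j * x < of_int n" "of_int n \<le> 2 ^ j * y" by (simp_all add: floor_less_iff le_floor_iff)
      hence "\<bar>G' (of_int n / 2 ^ j) - c\<bar> \<le> e" by (intro e) (auto simp: field_simps)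
      thus "\<bar>g' j n - c\<bar> \<le> K' * \<theta> ^ j + e" using G'.approx[of j "of_int n / 2 ^ j"] by simp
    qed (simp_all add: g')
    thus "\<exists>N. \<forall>j\<ge>N. \<bar>g j \<lfloor>2 ^ j * y\<rfloor> - g j \<lfloor>2 ^ j * x\<rfloor> - ?d j * c\<bar> \<le> ?d j * (K' * \<theta> ^ j + e)"
      by blast
  qed
  have "isCont G' x" using cont by (simp add: continuous_on_eq_continuous_at)
  show ?thesis
    unfolding has_field_derivative_def has_derivative_at_alt
  proof (intro conjI allI impI bounded_linear_mult_right)
    fix e :: real assume e: "e > 0"
    obtain d where d: "d > 0" "\<And>t. \<bar>t - x\<bar> < d \<Longrightarrow> \<bar>G' t - G' x\<bar> < e"
      using \<open>isCont G' x\<close> e unfolding continuous_at_eps_delta real_norm_def dist_real_def by metis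
    have "norm (G y - G x - G' x * (y - x)) \<le> e * norm (y - x)" if y: "norm (y - x) < d" for y
    proof (cases "x \<le> y")
      case True
      have "\<bar>G y - G x - (y - x) * G' x\<bar> \<le> (y - x) * e"
        using y True by (intro incr less_imp_le[OF d(2)]) auto
      thus ?thesis using True by (simp add: mult.commute)
    next
      case False
      have "\<bar>G x - G y - (x - y) * G' x\<bar> \<le> (x - y) * e"
        using y False by (intro incr less_imp_le[OF d(2)]) auto
      moreover have "G x - G y - (x - y) * G' x = - (G y - G x - G' x * (y - x))"
        by (simp add: algebra_simps)
      ultimately show ?thesis using False by (simp add: mult.commute)
    qed
    thus "\<exists>d>0. \<forall>y. norm (y - x) < d \<longrightarrow> norm (G y - G x - G' x * (y - x)) \<le> e * norm (y - x)"
      using d(1) by blast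
  qed
qed

section \<open>Differences of the subdivision scheme\<close>

text \<open>The generating function of the data at level j; one step is F(z) -> a(z) F(z^2).\<close>

primrec subdiv_laurent :: "laurent \<Rightarrow> laurent \<Rightarrow> nat \<Rightarrow> laurent" where
  "subdiv_laurent a f0 0 = f0"
| "subdiv_laurent a f0 (Suc j) = a * lsubst_pow 2 (subdiv_laurent a f0 j)"

lemma lookup_subdiv_laurent: "lcoeff (subdiv_laurent a f0 j) k = subdiv a f0 j k"
proof (induction j arbitrary: k)
  case 0
  show ?case by simp
next
  case (Suc j)
  let ?F = "subdiv_laurent a f0 j"
  have "subdiv a f0 (Suc j) k = Sum_any (\<lambda>l. lcoeff a (k - 2 * l) * lcoeff ?F l)"
    by (simp add: Suc)
  also have "\<dots> = (\<Sum>l\<in>Poly_Mapping.keys ?F. lcoeff a (k - 2 * l) * lcoeff ?F l)"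
    by (intro Sum_any.expand_superset) (auto simp: in_keys_iff)
  also have "\<dots> = lcoeff (subdiv_laurent a f0 (Suc j)) k"
    by (simp add: lookup_mult_lsubst_pow mult.commute)
  finally show ?case ..
qed

lemma lookup_one_plus_lZ_mult_lsubst_pow_2:
  "lcoeff ((1 + lZ) * lsubst_pow 2 H) k = lcoeff H (k div 2)"
proof -
  have "lcoeff ((1 + lZ) * lsubst_pow 2 H) k = lcoeff (lsubst_pow 2 H) k + lcoeff (lsubst_pow 2 H) (k - 1)"
    by (simp add: distrib_right lookup_add lookup_lZ_mult)
  also have "\<dots> = lcoeff H (k div 2)"
  proof (cases "even k")
    case True
    thus ?thesis by (simp add: lookup_lsubst_pow)
  next
    case False
    then obtain l where "k = 2 * l + 1" by (elim oddE)
    thus ?thesis by (simp add: lookup_lsubst_pow)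
  qed
  finally show ?thesis .
qed

lemma lconst_mult: "lconst c * lconst d = lconst (c * d)"
  by (simp add: lconst_def mult_single)

lemma abs_diff_le_of_steps:
  fixes h :: "int \<Rightarrow> real"
  assumes "\<And>n. \<bar>h n - h (n - 1)\<bar> \<le> E"
  shows "\<bar>h m - h n\<bar> \<le> of_int \<bar>m - n\<bar> * E"
proof -
  have *: "\<bar>h m - h n\<bar> \<le> of_int (m - n) * E" if "n \<le> m" for m n
    using that
  proof (induction m rule: int_ge_induct)
    case (step m)
    thus ?case using assms[of "m + 1"] by (simp add: algebra_simps)
  qed simp
  show ?thesis
    using *[of n m] *[of m n] by (cases "n \<le> m") (simp_all add: abs_minus_commute)
qed

text \<open>
  The factor \<open>1 + z\<close> makes each coefficient of \<open>H\<close> appear twice, so \<open>H'\<close> averages values of \<open>H\<close> near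
  \<open>k div 2\<close> with weights of sum \<open>s\<close>.
\<close>

lemma refinement_error:
  assumes "leval t 1 = of_real s"
    and H': "H' = (1 + lZ) * t * lsubst_pow 2 H"
    and E: "\<And>l. \<bar>lcoeff ((1 - lZ) * H) l\<bar> \<le> E"
  shows "\<bar>lcoeff H' k - s * lcoeff H (k div 2)\<bar> \<le>
    (\<Sum>i\<in>Poly_Mapping.keys t. \<bar>lcoeff t i\<bar> * of_int \<bar>i\<bar>) * E"
proof -
  have E0: "E \<ge> 0" using order_trans[OF abs_ge_zero E[of 0]] .
  have s: "s = (\<Sum>i\<in>Poly_Mapping.keys t. lcoeff t i)"
    using assms(1) by (simp add: leval_def flip: of_real_sum)
  have "H' = t * ((1 + lZ) * lsubst_pow 2 H)" by (simp add: H' mult_ac)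
  hence "lcoeff H' k = (\<Sum>i\<in>Poly_Mapping.keys t. lcoeff t i * lcoeff H ((k - i) div 2))"
    by (simp only: lookup_mult_eq_sum[of t] lookup_one_plus_lZ_mult_lsubst_pow_2)
  hence "\<bar>lcoeff H' k - s * lcoeff H (k div 2)\<bar> =
      \<bar>\<Sum>i\<in>Poly_Mapping.keys t. lcoeff t i * (lcoeff H ((k - i) div 2) - lcoeff H (k div 2))\<bar>"
    by (simp add: s sum_distrib_right sum_subtractf right_diff_distrib)
  also have "\<dots> \<le> (\<Sum>i\<in>Poly_Mapping.keys t. \<bar>lcoeff t i\<bar> * (of_int \<bar>i\<bar> * E))"
  proof (rule order_trans[OF sum_abs sum_mono])
    fix i
    have "\<bar>lcoeff H ((k - i) div 2) - lcoeff H (k div 2)\<bar> \<le> of_int \<bar>(k - i) div 2 - k div 2\<bar> * E"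
      by (rule abs_diff_le_of_steps) (use E in \<open>simp only: lookup_backward_diff\<close>)
    also have "\<bar>(k - i) div 2 - k div 2\<bar> \<le> \<bar>i\<bar>" by linarith
    hence "of_int \<bar>(k - i) div 2 - k div 2\<bar> * E \<le> of_int \<bar>i\<bar> * E"
      by (intro mult_right_mono E0) (simp only: of_int_le_iff)
    finally show "\<bar>lcoeff t i * (lcoeff H ((k - i) div 2) - lcoeff H (k div 2))\<bar>
        \<le> \<bar>lcoeff t i\<bar> * (of_int \<bar>i\<bar> * E)"
      unfolding abs_mult by (intro mult_left_mono) auto
  qed
  also have "\<dots> = (\<Sum>i\<in>Poly_Mapping.keys t. \<bar>lcoeff t i\<bar> * of_int \<bar>i\<bar>) * E"
    by (simp add: sum_distrib_right mult.assoc)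
  finally show ?thesis .
qed

text \<open>A perturbation of rate \<theta> dominates a recursion whose own factor s is smaller than
  \<theta>.\<close>

lemma contraction_bound:
  fixes u :: "nat \<Rightarrow> int \<Rightarrow> real"
  assumes init: "\<And>k. \<bar>u 0 k\<bar> \<le> U"
    and step: "\<And>j k. \<bar>u (Suc j) k - s * u j (k div 2)\<bar> \<le> C * \<theta> ^ j"
    and s: "0 \<le> s" "s < \<theta>"
  shows "\<exists>C'. \<forall>j k. \<bar>u j k\<bar> \<le> C' * \<theta> ^ j"
proof -
  \<comment> \<open>The first entry covers the start; the second makes s C' + C <= C' \<theta>,
    which closes the induction.\<close>
  define C' where "C' = max U (C / (\<theta> - s))"
  have "C / (\<theta> - s) \<le> C'" by (simp add: C'_def)
  hence C': "s * C' + C \<le> C' * \<theta>"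
    using s by (simp add: pos_divide_le_eq algebra_simps)
  have "\<bar>u j k\<bar> \<le> C' * \<theta> ^ j" for j k
  proof (induction j arbitrary: k)
    case 0
    show ?case using init[of k] by (simp add: C'_def)
  next
    case (Suc j)
    have "\<bar>s * u j (k div 2)\<bar> \<le> s * (C' * \<theta> ^ j)"
      unfolding abs_mult using s Suc by (intro mult_mono) auto
    hence "\<bar>u (Suc j) k\<bar> \<le> (s * C' + C) * \<theta> ^ j"
      using step[of j k] by (simp add: algebra_simps)
    also have "\<dots> \<le> C' * \<theta> * \<theta> ^ j"
      using s C' by (intro mult_right_mono) auto
    finally show ?case by simp
  qed
  thus ?thesis by blast
qed

section \<open>Difference schemes of a factorized mask\<close>

locale factorized_mask =
  fixes a b :: laurent and r :: nat
  assumes mask: "a = lconst (1 / 2 ^ r) * (1 + lZ) ^ (r + 1) * b"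
    and a1: "leval a 1 = 2"
begin

lemma leval_b_1: "leval b 1 = 1"
proof -
  have "leval a 1 = 2 * leval b 1" by (simp add: mask)
  thus ?thesis using a1 by simp
qed

text \<open>Multiplication by 1 - z is the backward difference, so these are the differences of
  order m at level j, without division by powers of the grid width.\<close>

definition diff_data :: "laurent \<Rightarrow> nat \<Rightarrow> nat \<Rightarrow> laurent" where
  "diff_data f0 m j = (1 - lZ) ^ m * subdiv_laurent a f0 j"

lemma lookup_diff_data_Suc:
  "lcoeff (diff_data f0 (Suc m) j) k = lcoeff (diff_data f0 m j) k - lcoeff (diff_data f0 m j) (k - 1)"
  by (simp add: diff_data_def mult.assoc lookup_backward_diff)

text \<open>Since 1 - z^2 = (1 - z)(1 + z), each order of differences uses up one factor 1 + z of
  the mask.\<close>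

lemma diff_data_step:
  assumes "m \<le> r + 1"
  shows "diff_data f0 m (Suc j) =
    lconst (1 / 2 ^ r) * (1 + lZ) ^ (r + 1 - m) * b * lsubst_pow 2 (diff_data f0 m j)"
proof -
  have "lsubst_pow 2 (1 - lZ) = (1 - lZ) * (1 + lZ)"
    by (simp add: lsubst_pow_diff lsubst_pow_one lsubst_pow_lZ power2_eq_square algebra_simps)
  hence "lsubst_pow 2 (diff_data f0 m j) =
      (1 - lZ) ^ m * (1 + lZ) ^ m * lsubst_pow 2 (subdiv_laurent a f0 j)"
    by (simp add: diff_data_def lsubst_pow_mult lsubst_pow_power power_mult_distrib)
  moreover have "(1 + lZ) ^ (r + 1) = (1 + lZ) ^ (r + 1 - m) * (1 + lZ) ^ m"
    using assms by (simp flip: power_add)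
  ultimately show ?thesis
    by (simp only: diff_data_def subdiv_laurent.simps) (simp only: mask mult_ac)
qed

text \<open>For \<open>m <= r\<close> a factor 1 + z is left over for
  \<open>refinement_error\<close>; the remaining mask \<open>t\<close> has t(1) = 2^(-r) 2^(r-m)
  b(1) = 2^(-m). The constant \<open>K\<close> depends on \<open>t\<close> alone, so it serves all
  levels.\<close>

lemma diff_data_refinement:
  assumes m: "m \<le> r"
  shows "\<exists>K\<ge>0. \<forall>j E k. (\<forall>l. \<bar>lcoeff (diff_data f0 (Suc m) j) l\<bar> \<le> E) \<longrightarrow>
    \<bar>lcoeff (diff_data f0 m (Suc j)) k - 1 / 2 ^ m * lcoeff (diff_data f0 m j) (k div 2)\<bar> \<le> K * E"
proof -
  define t where "t = lconst (1 / 2 ^ r) * (1 + lZ) ^ (r - m) * b"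
  define K where "K = (\<Sum>i\<in>Poly_Mapping.keys t. \<bar>lcoeff t i\<bar> * of_int \<bar>i\<bar>)"
  have "(2 :: complex) ^ r = 2 ^ (r - m) * 2 ^ m" using m by (simp flip: power_add)
  hence t1: "leval t 1 = of_real (1 / 2 ^ m)"
    by (simp add: t_def leval_b_1)
  have "r + 1 - m = Suc (r - m)" using m by simp
  hence step: "diff_data f0 m (Suc j) = (1 + lZ) * t * lsubst_pow 2 (diff_data f0 m j)" for j
    using m by (simp add: diff_data_step t_def mult_ac)
  have diff: "(1 - lZ) * diff_data f0 m j = diff_data f0 (Suc m) j" for j
    by (simp add: diff_data_def mult.assoc)
  have "\<forall>j E k. (\<forall>l. \<bar>lcoeff (diff_data f0 (Suc m) j) l\<bar> \<le> E) \<longrightarrow>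
    \<bar>lcoeff (diff_data f0 m (Suc j)) k - 1 / 2 ^ m * lcoeff (diff_data f0 m j) (k div 2)\<bar> \<le> K * E"
    unfolding K_def using refinement_error[OF t1 step, unfolded diff] by blast
  moreover have "K \<ge> 0" unfolding K_def by (intro sum_nonneg) auto
  ultimately show ?thesis by blast
qed

text \<open>At order r + 1 all factors 1 + z are used up and each step multiplies by 2^(-r) b(z)
  only.\<close>

lemma diff_data_top:
  "diff_data f0 (r + 1) j =
    lconst ((1 / 2 ^ r) ^ j) * (iterated_symbol b j * lsubst_pow (2 ^ j) (diff_data f0 (r + 1) 0))"
proof (induction j)
  case 0
  have "lsubst_pow 1 p = p" for p by (rule poly_mapping_eqI) (simp add: lookup_lsubst_pow)
  thus ?case by (simp add: iterated_symbol_def lconst_def)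
next
  case (Suc j)
  show ?case
    by (subst diff_data_step, simp, subst Suc)
       (simp add: lsubst_pow_mult lsubst_pow_lconst lsubst_pow_lsubst_pow iterated_symbol_Suc mult_ac
         lconst_mult[symmetric] power_Suc del: times_divide_eq_right times_divide_eq_left mult_1_right)
qed

lemma diff_data_top_bound:
  assumes b: "\<And>n k. \<bar>lcoeff (iterated_symbol b n) k\<bar> \<le> C * c ^ n"
  shows "\<exists>C'. \<forall>j k. \<bar>lcoeff (diff_data f0 (r + 1) j) k\<bar> \<le> C' * (c / 2 ^ r) ^ j"
proof -
  let ?g = "diff_data f0 (r + 1) 0"
  define S where "S = (\<Sum>l\<in>Poly_Mapping.keys ?g. \<bar>lcoeff ?g l\<bar>)"
  have "\<bar>lcoeff (diff_data f0 (r + 1) j) k\<bar> \<le> S * C * (c / 2 ^ r) ^ j" for j k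
  proof -
    have "\<bar>lcoeff (iterated_symbol b j * lsubst_pow (2 ^ j) ?g) k\<bar> \<le> S * (C * c ^ j)"
      unfolding S_def sum_distrib_right lookup_mult_lsubst_pow[OF zero_less_power[OF zero_less_numeral]]
      by (intro sum_abs[THEN order_trans] sum_mono) (auto simp: abs_mult intro!: mult_left_mono b)
    hence "(1 / 2 ^ r) ^ j * \<bar>lcoeff (iterated_symbol b j * lsubst_pow (2 ^ j) ?g) k\<bar>
        \<le> (1 / 2 ^ r) ^ j * (S * (C * c ^ j))"
      by (intro mult_left_mono) auto
    moreover have "\<bar>lcoeff (diff_data f0 (r + 1) j) k\<bar> =
        (1 / 2 ^ r) ^ j * \<bar>lcoeff (iterated_symbol b j * lsubst_pow (2 ^ j) ?g) k\<bar>"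
      by (subst diff_data_top) (simp add: lookup_lconst_mult abs_mult)
    ultimately show ?thesis by (simp add: power_divide mult_ac)
  qed
  thus ?thesis by blast
qed

text \<open>Downward induction from order r + 1: the bound at order m + 1 is the perturbation in the
  recursion at order m, whose own factor is 2^(-m).\<close>

lemma diff_data_bound:
  assumes top: "\<And>j k. \<bar>lcoeff (diff_data f0 (r + 1) j) k\<bar> \<le> C * (2 powr (- \<beta>)) ^ j"
    and \<delta>: "\<delta> \<le> \<beta>" "\<delta> < real m" and m: "m \<le> r + 1"
  shows "\<exists>C'. \<forall>j k. \<bar>lcoeff (diff_data f0 m j) k\<bar> \<le> C' * (2 powr (- \<delta>)) ^ j"
  using m \<delta>(2)
proof (induction m rule: inc_induct)
  case base
  have "C \<ge> 0" using order_trans[OF abs_ge_zero top[of 0 0]] by simp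
  hence "C * (2 powr (- \<beta>)) ^ j \<le> C * (2 powr (- \<delta>)) ^ j" for j
    using \<delta>(1) by (intro mult_left_mono power_mono) auto
  thus ?case using top order_trans by blast
next
  case (step m)
  obtain C where C: "\<And>j k. \<bar>lcoeff (diff_data f0 (Suc m) j) k\<bar> \<le> C * (2 powr (- \<delta>)) ^ j"
    using step by force
  obtain K where "K \<ge> 0" and K: "\<And>j E k. (\<And>l. \<bar>lcoeff (diff_data f0 (Suc m) j) l\<bar> \<le> E) \<Longrightarrow>
      \<bar>lcoeff (diff_data f0 m (Suc j)) k - 1 / 2 ^ m * lcoeff (diff_data f0 m j) (k div 2)\<bar> \<le> K * E"
    using diff_data_refinement[of m f0] step(2) by auto
  show ?case
  proof (rule contraction_bound)
    fix k show "\<bar>lcoeff (diff_data f0 m 0) k\<bar> \<le>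
        (\<Sum>i\<in>Poly_Mapping.keys (diff_data f0 m 0). \<bar>lcoeff (diff_data f0 m 0) i\<bar>)"
      by (rule abs_lookup_le_sum)
  next
    fix j k
    show "\<bar>lcoeff (diff_data f0 m (Suc j)) k - 1 / 2 ^ m * lcoeff (diff_data f0 m j) (k div 2)\<bar>
        \<le> K * C * (2 powr (- \<delta>)) ^ j"
      using K[OF C] by (simp add: mult.assoc)
  next
    \<comment> \<open>Here \<delta> < m enters: the recursion must contract faster than the claimed
      rate.\<close>
    have "1 / 2 ^ m = 2 powr (- real m)" by (simp add: powr_minus powr_realpow divide_inverse)
    also have "\<dots> < 2 powr (- \<delta>)" using step by (intro powr_less_mono) auto
    finally show "1 / 2 ^ m < 2 powr (- \<delta>)" .
  qed simp
qed

section \<open>Regularity of the limit function\<close>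

text \<open>The scaling 2^(mj) cancels the factor 2^(-m) of the refinement rule, so that
  \<open>g\<close> changes from level to level only by an error governed by the differences of order
  m + 1.\<close>

lemma divided_difference_limit:
  assumes top: "\<And>j k. \<bar>lcoeff (diff_data f0 (r + 1) j) k\<bar> \<le> C * (2 powr (- \<beta>)) ^ j"
    and \<alpha>: "0 < \<alpha>" "\<alpha> < 1" and m: "m \<le> r" "real m + \<alpha> \<le> \<beta>"
  defines "g \<equiv> \<lambda>j k. 2 ^ (m * j) * lcoeff (diff_data f0 m j) k"
  shows "\<exists>G K C'. dyadic_step_approx g G K (2 powr (- \<alpha>)) \<and> hoelder_continuous \<alpha> G \<and>
    (\<forall>j k. \<bar>g j k - g j (k - 1)\<bar> \<le> C' * (2 powr (- \<alpha>)) ^ j)"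
proof -
  let ?\<theta> = "2 powr (- \<alpha>)"
  have \<theta>: "0 < ?\<theta>" "?\<theta> < 1"
    using \<alpha> powr_less_mono[of "- \<alpha>" 0 2] by auto
  \<comment> \<open>The rate is \<delta> = m + \<alpha>, admissible at order m + 1 because \<alpha>
    < 1.\<close>
  obtain C' where C': "\<And>j k. \<bar>lcoeff (diff_data f0 (Suc m) j) k\<bar> \<le> C' * (2 powr (- (real m + \<alpha>))) ^ j"
    using diff_data_bound[OF top m(2), of "Suc m"] \<alpha> m by auto
  have scale: "2 ^ (m * j) * (2 powr (- (real m + \<alpha>))) ^ j = ?\<theta> ^ j" for j
  proof -
    have "2 ^ (m * j) * (2 powr (- (real m + \<alpha>))) ^ j = (2 ^ m * 2 powr (- (real m + \<alpha>))) ^ j"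
      by (simp add: power_mult power_mult_distrib)
    also have "2 ^ m * 2 powr (- (real m + \<alpha>)) = ?\<theta>"
      by (simp add: powr_realpow[symmetric] flip: powr_add)
    finally show ?thesis .
  qed
  have diff: "\<bar>g j k - g j (k - 1)\<bar> \<le> C' * ?\<theta> ^ j" for j k
  proof -
    have "g j k - g j (k - 1) = 2 ^ (m * j) * lcoeff (diff_data f0 (Suc m) j) k"
      by (simp add: g_def lookup_diff_data_Suc right_diff_distrib)
    also have "\<bar>\<dots>\<bar> \<le> 2 ^ (m * j) * (C' * (2 powr (- (real m + \<alpha>))) ^ j)"
      unfolding abs_mult by (intro mult_mono C') auto
    also have "\<dots> = C' * ?\<theta> ^ j" using scale[of j] by (simp add: mult_ac)
    finally show ?thesis .
  qed
  obtain K where K: "\<And>j E k. (\<And>l. \<bar>lcoeff (diff_data f0 (Suc m) j) l\<bar> \<le> E) \<Longrightarrow>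
      \<bar>lcoeff (diff_data f0 m (Suc j)) k - 1 / 2 ^ m * lcoeff (diff_data f0 m j) (k div 2)\<bar> \<le> K * E"
    using diff_data_refinement[OF m(1), of f0] by blast
  have refine: "\<bar>g (Suc j) k - g j (k div 2)\<bar> \<le> 2 ^ m * K * C' * ?\<theta> ^ j" for j k
  proof -
    have "g (Suc j) k - g j (k div 2) = 2 ^ (m * Suc j) *
        (lcoeff (diff_data f0 m (Suc j)) k - 1 / 2 ^ m * lcoeff (diff_data f0 m j) (k div 2))"
      by (simp add: g_def power_add right_diff_distrib)
    also have "\<bar>\<dots>\<bar> \<le> 2 ^ (m * Suc j) * (K * (C' * (2 powr (- (real m + \<alpha>))) ^ j))"
      unfolding abs_mult by (intro mult_mono K C') auto
    also have "\<dots> = 2 ^ m * K * C' * ?\<theta> ^ j"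
      unfolding scale[of j, symmetric] by (simp add: power_add mult_ac)
    finally show ?thesis .
  qed
  obtain G :: "real \<Rightarrow> real" where G: "\<And>j x. \<bar>g j \<lfloor>2 ^ j * x\<rfloor> - G x\<bar> \<le> 2 ^ m * K * C' / (1 - ?\<theta>) * ?\<theta> ^ j"
    by (rule dyadic_step_limit[of "2 powr (- \<alpha>)" g, OF \<theta> refine]) (rule that)
  interpret G: dyadic_step_approx g G "2 ^ m * K * C' / (1 - ?\<theta>)" ?\<theta>
    by standard (use \<theta> G in auto)
  have "hoelder_continuous \<alpha> G"
  proof (rule G.limit_hoelder[OF refl _ diff])
    fix k
    show "\<bar>g 0 k\<bar> \<le> (\<Sum>i\<in>Poly_Mapping.keys (diff_data f0 m 0). \<bar>lcoeff (diff_data f0 m 0) i\<bar>)"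
      using abs_lookup_le_sum[of "diff_data f0 m 0" k] by (simp add: g_def)
  qed
  thus ?thesis using G.dyadic_step_approx_axioms diff by blast
qed

lemma limit_function_in_hoelder_class:
  assumes top: "\<And>j k. \<bar>lcoeff (diff_data f0 (r + 1) j) k\<bar> \<le> C * (2 powr (- \<beta>)) ^ j"
    and \<alpha>: "0 < \<alpha>" "\<alpha> < 1" and q: "q \<le> r" "real q + \<alpha> \<le> \<beta>"
  shows "\<exists>f. is_limit_function a f0 f \<and> cont_diff q f \<and> hoelder_continuous \<alpha> ((deriv ^^ q) f)"
proof -
  define \<theta> where "\<theta> = 2 powr (- \<alpha>)"
  define g where "g m j k = 2 ^ (m * j) * lcoeff (diff_data f0 m j) k" for m j k
  \<comment> \<open>The guard \<open>m <= q\<close> stands inside the existential so that limits and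
    constants can be chosen as functions of m.\<close>
  have "\<forall>m. \<exists>G K C'. m \<le> q \<longrightarrow> dyadic_step_approx (g m) G K \<theta> \<and> hoelder_continuous \<alpha> G \<and>
      (\<forall>j k. \<bar>g m j k - g m j (k - 1)\<bar> \<le> C' * \<theta> ^ j)"
  proof
    fix m
    show "\<exists>G K C'. m \<le> q \<longrightarrow> dyadic_step_approx (g m) G K \<theta> \<and> hoelder_continuous \<alpha> G \<and>
      (\<forall>j k. \<bar>g m j k - g m j (k - 1)\<bar> \<le> C' * \<theta> ^ j)"
      using divided_difference_limit[OF top \<alpha>, of m] q
      by (cases "m \<le> q") (auto simp: g_def[abs_def] \<theta>_def)
  qed
  then obtain G K C' where
    approx: "\<And>m. m \<le> q \<Longrightarrow> dyadic_step_approx (g m) (G m) (K m) \<theta>" and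
    hoelder: "\<And>m. m \<le> q \<Longrightarrow> hoelder_continuous \<alpha> (G m)" and
    diff: "\<And>m j k. m \<le> q \<Longrightarrow> \<bar>g m j k - g m j (k - 1)\<bar> \<le> C' m * \<theta> ^ j"
    by metis
  have cont: "continuous_on UNIV (G m)" if "m \<le> q" for m
    by (rule hoelder_continuous_imp_continuous[OF hoelder[OF that] \<alpha>(1)])
  have deriv: "(G m has_real_derivative G (Suc m) x) (at x)" if "m < q" for m x
  proof (rule dyadic_step_limit_has_derivative[OF approx approx])
    fix j k
    \<comment> \<open>Consecutive orders are related exactly as the differentiation lemma
      asks.\<close>
    show "g (Suc m) j k = 2 ^ j * (g m j k - g m j (k - 1))"
      by (simp add: g_def lookup_diff_data_Suc power_add algebra_simps)
  qed (use that cont in auto)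
  have iter: "(deriv ^^ m) (G 0) = G m" if "m \<le> q" for m
    using that
  proof (induction m)
    case (Suc m)
    have "deriv (G m) = G (Suc m)"
      using Suc.prems deriv[of m] by (auto simp: fun_eq_iff intro!: DERIV_imp_deriv)
    thus ?case using Suc by simp
  qed simp
  have "is_limit_function a f0 (G 0)"
    unfolding is_limit_function_def
  proof
    fix x
    have "g 0 j k = subdiv a f0 j k" for j k
      by (simp add: g_def diff_data_def lookup_subdiv_laurent)
    moreover have "(\<lambda>j. (1 - frac (2 ^ j * x)) * g 0 j \<lfloor>2 ^ j * x\<rfloor>
        + frac (2 ^ j * x) * g 0 j (\<lfloor>2 ^ j * x\<rfloor> + 1)) \<longlonglongrightarrow> G 0 x"
      by (rule dyadic_step_approx.piecewise_linear_tendsto[OF approx diff]) auto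
    ultimately show "(\<lambda>j. subdiv_pl a f0 j x) \<longlonglongrightarrow> G 0 x"
      by (simp add: subdiv_pl_def)
  qed
  moreover have "cont_diff q (G 0)"
    unfolding cont_diff_def using deriv by (auto simp: iter cont real_differentiable_def)
  ultimately show ?thesis using hoelder iter by auto
qed

end

theorem theorem1:
  fixes a b :: "int \<Rightarrow>\<^sub>0 real" and r p :: nat and \<rho> :: real
  assumes "leval a (-1) = 0"
    and "leval a 1 = 2"
    and "a = lconst (1 / 2 ^ r) * (1 + lZ) ^ (r + 1) * b"
    and "p \<ge> 1"
    and "lcoeff b (int p) \<noteq> 0"
    and "\<And>k. \<bar>k\<bar> > int p \<Longrightarrow> lcoeff b k = 0"
    and "\<And>k. lcoeff b (- k) = lcoeff b k"
    and "\<rho> = real_spectral_radius (symbol_mat b p)"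
    and "\<And>\<xi>. \<xi> \<in> {- pi..pi} \<Longrightarrow> trig_symbol b p \<xi> \<ge> 0"
  shows "(\<lambda>j. root j (lcoeff (iterated_symbol b j) 0)) \<longlonglongrightarrow> \<rho>
    \<and> (\<rho> \<ge> 1 / 2 \<longrightarrow>
        (\<forall>\<beta>. 0 \<le> \<beta> \<and> \<beta> < real r - log 2 \<rho> \<longrightarrow>
          (\<forall>f0. \<exists>f. is_limit_function a f0 f \<and> f \<in> hoelder_class \<beta>)))"
proof (intro conjI impI allI)
  have pos: "leval b z \<in> \<real>\<^sub>\<ge>\<^sub>0" if "norm z = 1" for z
    using that assms(6,7,9) by (intro leval_nonneg_of_trig_symbol_nonneg[of p b])
  show "(\<lambda>j. root j (lcoeff (iterated_symbol b j) 0)) \<longlonglongrightarrow> \<rho>"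
    unfolding assms(8) by (rule root_iterated_symbol_tendsto[OF assms(4,6) pos])
  interpret factorized_mask a b r
    by standard (fact assms(3), fact assms(2))
  fix \<beta> f0 assume \<rho>: "\<rho> \<ge> 1 / 2" and "0 \<le> \<beta> \<and> \<beta> < real r - log 2 \<rho>"
  hence \<beta>: "0 \<le> \<beta>" "\<beta> < real r - log 2 \<rho>" by auto
  define q where "q = nat \<lfloor>\<beta>\<rfloor>"
  have q: "real q = of_int \<lfloor>\<beta>\<rfloor>" using \<beta> by (simp add: q_def)
  \<comment> \<open>The bound \<rho> >= 1/2 gives \<beta> < r + 1, hence q <= r: differences of
    order q still have a factor 1 + z to spare.\<close>
  have "log 2 (1 / 2) \<le> log 2 \<rho>" using \<rho> by (intro log_mono) auto
  hence "log 2 \<rho> \<ge> - 1" by (simp add: log_divide)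
  hence "real q < real r + 1" using q \<beta> of_int_floor_le[of \<beta>] by linarith
  hence "q \<le> r" by linarith
  \<comment> \<open>For integral \<open>\<beta>\<close> there is room for a slightly larger exponent.\<close>
  obtain \<alpha> where \<alpha>: "0 < \<alpha>" "\<alpha> < 1" "real q + \<alpha> < real r - log 2 \<rho>" "frac \<beta> > 0 \<Longrightarrow> \<alpha> = frac \<beta>"
  proof (cases "frac \<beta> > 0")
    case True
    thus ?thesis using that[of "frac \<beta>"] \<beta> q frac_lt_1[of \<beta>] by (simp add: frac_def)
  next
    case False
    hence "real q = \<beta>" using q frac_ge_0[of \<beta>] unfolding frac_def by linarith
    then obtain \<alpha> where "0 < \<alpha>" "\<alpha> < min 1 (real r - log 2 \<rho> - \<beta>)"
      using \<beta> dense[of 0 "min 1 (real r - log 2 \<rho> - \<beta>)"] by auto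
    thus ?thesis using that[of \<alpha>] False \<open>real q = \<beta>\<close> by auto
  qed
  \<comment> \<open>Chosen so that c / 2^r is the rate 2^(-(q + \<alpha>)); then \<rho> < c says
    exactly that q + \<alpha> < r - log 2 \<rho>.\<close>
  define c where "c = 2 powr (real r - (real q + \<alpha>))"
  have "\<rho> = 2 powr log 2 \<rho>" using \<rho> by simp
  also have "\<dots> < c" unfolding c_def using \<alpha> by (intro powr_less_mono) auto
  finally obtain C where "\<And>n k. \<bar>lcoeff (iterated_symbol b n) k\<bar> \<le> C * c ^ n"
    using iterated_symbol_bound[OF assms(4,6) pos, of c] assms(8) by blast
  from diff_data_top_bound[OF this, of f0] obtain C'
    where "\<And>j k. \<bar>lcoeff (diff_data f0 (r + 1) j) k\<bar> \<le> C' * (c / 2 ^ r) ^ j" by blast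
  moreover have "c / 2 ^ r = 2 powr (- (real q + \<alpha>))"
    by (simp add: c_def powr_realpow[symmetric] flip: powr_diff)
  ultimately have "\<exists>f. is_limit_function a f0 f \<and> cont_diff q f \<and> hoelder_continuous \<alpha> ((deriv ^^ q) f)"
    using \<alpha> \<open>q \<le> r\<close> by (intro limit_function_in_hoelder_class[of f0 C' "real q + \<alpha>"]) auto
  \<comment> \<open>For fractional \<beta> the exponent \<alpha> is \<open>frac \<beta>\<close>; for
    integral \<beta> the class asks for \<open>cont_diff\<close> only.\<close>
  thus "\<exists>f. is_limit_function a f0 f \<and> f \<in> hoelder_class \<beta>"
    using \<alpha>(4) unfolding hoelder_class_def q_def by blast
qed

end
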